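(* Let $(W,S)$ be a finite irreducible Coxeter system with Coxeter number $h$. Then $\max_{F\in\mathrm{Mac}(W)}\min\{t\in\mathbb Z_{\ge0}: \mathrm{MacPop}^t(F)=W\}=h-1.$
   Context: $W$ carries the Bruhat order $\leq_{\mathsf B}$. $\mathrm{Mac}(W)$ is the set of order filters $F$ of $W$ with $F=\mathrm{U}(\mathrm{L}(F))$, where $\mathrm{U}(X)$ (resp. $\mathrm{L}(X)$) is the set of elements $\geq$ (resp. $\leq$) every element of $X$; $W$ itself is its minimum (under reverse inclusion). For $s\in S$, $\pi_s(w)=sw$ if $\ell(sw)<\ell(w)$ and $\pi_s(w)=w$ otherwise; for $u\in W$, $\pi_u=\pi_{s_1}\cdots\pi_{s_k}$ for a reduced word $s_1\cdots s_k$ of $u$. For $F\in\mathrm{Mac}(W)$, $\tau_u(F)=\{w\in W:\pi_u(x)\leq_{\mathsf B} w\text{ for some }x\in F\}$, and $\mathrm{Des}(F)=\{s\in S:\tau_s(F)\ne F\}$. For $J\subseteq S$, $w_\circ(J)$ is the longest element of the parabolic subgroup $W_J$. The MacNeille pop-stack operator is $\mathrm{MacPop}(F)=\tau_{w_\circ(\mathrm{Des}(F))}(F)$. *)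

theory Defs
  imports "HOL-Algebra.Algebra"
begin

definition word_val :: "('a, 'b) monoid_scheme \<Rightarrow> 'a list \<Rightarrow> 'a" where
  "word_val W ws = foldr (\<otimes>\<^bsub>W\<^esub>) ws \<one>\<^bsub>W\<^esub>"

text \<open>
  Deletion of one Coxeter relator \<open>(s t)\<^sup>m\<close>, where \<open>m\<close> is the order of \<open>s t\<close>, inside a word
  over \<open>S\<close>. Since \<open>group.ord\<close> is \<open>0\<close> on elements of infinite order, a pair with \<open>m = \<infinity>\<close>
  contributes only the trivial relation. The pairs with \<open>s = t\<close> have \<open>m = 1\<close> and contribute
  the relators \<open>s s\<close>.
\<close>

inductive coxeter_step :: "('a, 'b) monoid_scheme \<Rightarrow> 'a set \<Rightarrow> 'a list \<Rightarrow> 'a list \<Rightarrow> bool"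
  for W S where
  "\<lbrakk>us \<in> lists S; vs \<in> lists S; s \<in> S; t \<in> S\<rbrakk> \<Longrightarrow>
    coxeter_step W S
      (us @ concat (replicate (group.ord W (s \<otimes>\<^bsub>W\<^esub> t)) [s, t]) @ vs) (us @ vs)"

text \<open>
  The last assumption says that \<open>W\<close> is presented by the generators \<open>S\<close> and the Coxeter relators: two words have
  the same value iff they are connected by insertions and deletions of relators. Words in the
  letters of \<open>S\<close> suffice, without formal inverses, because the relators \<open>s s\<close> are present.
\<close>

locale coxeter_system = group W for W (structure) +
  fixes S :: "'a set"
  assumes S_carrier: "S \<subseteq> carrier W"
    and S_order: "\<And>s. s \<in> S \<Longrightarrow> ord s = 2"
    and S_generates: "generate W S = carrier W"
    and S_presentation:
      "\<And>us vs. \<lbrakk>us \<in> lists S; vs \<in> lists S\<rbrakk> \<Longrightarrow>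
        word_val W us = word_val W vs \<longleftrightarrow> equivclp (coxeter_step W S) us vs"
begin

text \<open>Connectedness of the Coxeter graph, whose edges are the pairs with \<open>m \<ge> 3\<close> or \<open>m = \<infinity>\<close>.\<close>

definition coxeter_edge :: "'a \<Rightarrow> 'a \<Rightarrow> bool" where
  "coxeter_edge s t \<longleftrightarrow> s \<in> S \<and> t \<in> S \<and> ord (s \<otimes> t) \<notin> {1, 2}"

definition irreducible_system :: bool where
  "irreducible_system \<longleftrightarrow> S \<noteq> {} \<and> (\<forall>s\<in>S. \<forall>t\<in>S. coxeter_edge\<^sup>*\<^sup>* s t)"

definition coxeter_element :: "'a \<Rightarrow> bool" where
  "coxeter_element c \<longleftrightarrow> (\<exists>ws. distinct ws \<and> set ws = S \<and> c = word_val W ws)"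

text \<open>
  A predicate rather than a function: in the finite case all Coxeter elements are conjugate, so
  exactly one \<open>h\<close> satisfies it.
\<close>

definition is_coxeter_number :: "nat \<Rightarrow> bool" where
  "is_coxeter_number h \<longleftrightarrow> (\<exists>c. coxeter_element c \<and> h = ord c)"

definition len :: "'a \<Rightarrow> nat" where
  "len w = (LEAST n. \<exists>ws\<in>lists S. length ws = n \<and> word_val W ws = w)"

definition reduced_word :: "'a \<Rightarrow> 'a list \<Rightarrow> bool" where
  "reduced_word w ws \<longleftrightarrow> ws \<in> lists S \<and> word_val W ws = w \<and> length ws = len w"

definition reflections :: "'a set" where
  "reflections = {w \<otimes> s \<otimes> inv w | w s. w \<in> carrier W \<and> s \<in> S}"

definition bruhat_step :: "'a \<Rightarrow> 'a \<Rightarrow> bool" where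
  "bruhat_step u w \<longleftrightarrow> u \<in> carrier W \<and> (\<exists>t\<in>reflections. w = u \<otimes> t) \<and> len u < len w"

definition bruhat_le :: "'a \<Rightarrow> 'a \<Rightarrow> bool" where
  "bruhat_le = bruhat_step\<^sup>*\<^sup>*"

definition bruhat_order :: "'a gorder" where
  "bruhat_order = \<lparr>carrier = carrier W, eq = (=), le = bruhat_le\<rparr>"

definition order_filter :: "'a set \<Rightarrow> bool" where
  "order_filter F \<longleftrightarrow>
    F \<subseteq> carrier W \<and> (\<forall>x\<in>F. \<forall>y\<in>carrier W. bruhat_le x y \<longrightarrow> y \<in> F)"

definition Mac :: "'a set set" where
  "Mac = {F. order_filter F \<and> F = Upper bruhat_order (Lower bruhat_order F)}"

definition pi_gen :: "'a \<Rightarrow> 'a \<Rightarrow> 'a" where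
  "pi_gen s w = (if len (s \<otimes> w) < len w then s \<otimes> w else w)"

text \<open>
  The operators \<open>pi_gen s\<close> satisfy the braid relations, so the choice of the reduced word is
  immaterial.
\<close>

definition pi_op :: "'a \<Rightarrow> 'a \<Rightarrow> 'a" where
  "pi_op u = foldr pi_gen (SOME ws. reduced_word u ws)"

definition tau :: "'a \<Rightarrow> 'a set \<Rightarrow> 'a set" where
  "tau u F = {w \<in> carrier W. \<exists>x\<in>F. bruhat_le (pi_op u x) w}"

definition Des :: "'a set \<Rightarrow> 'a set" where
  "Des F = {s \<in> S. tau s F \<noteq> F}"

definition longest :: "'a set \<Rightarrow> 'a" where
  "longest J = (THE w. is_arg_max len (\<lambda>w. w \<in> generate W J) w)"

definition MacPop :: "'a set \<Rightarrow> 'a set" where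
  "MacPop F = tau (longest (Des F)) F"

end

end

theory Submission
  imports Defs "HOL-Library.Sublist"
begin

text \<open>
  The Coxeter graph of a finite irreducible group is a tree; colour it with two colours and let
  \<open>c\<^sub>1\<close>, \<open>c\<^sub>2\<close> be the products of the generators of each colour. All Coxeter elements have the
  order of \<open>c\<^sub>1 c\<^sub>2\<close>. In the geometric representation the images of the simple roots under the
  alternating products \<open>c\<^sub>1 c\<^sub>2 c\<^sub>1 \<dots>\<close> are given by the Chebyshev polynomials \<open>U\<^sub>k\<close> of the (weighted)
  adjacency matrix \<open>A\<close>. Since a root has coordinates of one sign, \<open>U\<^sub>k \<ge> 0\<close> up to the first \<open>k = m\<close>
  at which some column of \<open>U\<^sub>k\<close> vanishes; as \<open>U\<^sub>m\<close> commutes with \<open>A\<close> and the graph is connected,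
  \<open>U\<^sub>m = 0\<close>. It follows that both alternating products of \<open>m + 1\<close> blocks are reduced and equal to
  the longest element, hence \<open>h = m + 1\<close>.

  For the upper bound, one application of \<open>MacPop\<close> strips a whole block off an element of
  \<open>F\<close>. Starting from the longest element in its two block decompositions, \<open>m\<close> applications yield
  both \<open>c\<^sub>1\<close> and \<open>c\<^sub>2\<close>. Their only common lower bound is \<open>1\<close>, so the filter, being closed under
  \<open>U \<circ> L\<close>, is all of \<open>W\<close>. For the lower bound, on the principal filter of an alternating product of
  \<open>m\<close> blocks the operator strips exactly one block at a time.
\<close>

subsection \<open>Words and length\<close>

context coxeter_system
begin

text \<open>Exchange and the signs of roots are derived from the presentation through the geometric
  representation alone; no classification of finite Coxeter groups enters. Irreducibility matters
  because the components of a disconnected graph would in general have their first vanishing columns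
  at different indices. For the upper bound, the obstacle is that \<open>Des F\<close> for a general
  filter bears no relation to the two colours. The argument therefore never computes
  \<open>MacPop F\<close>; it only exhibits members of it, following two chains of block products at
  once, one for each leading colour. For the lower bound, the principal filter must start one block
  below the longest element: the left descents of the longest element are all of S, so its principal
  filter would reach W in a single step, whereas with m blocks the left descents form exactly one
  colour class.\<close>

abbreviation wv :: "'a list \<Rightarrow> 'a" where "wv \<equiv> word_val W"

lemma wv_Nil [simp]: "wv [] = \<one>"
  by (simp add: word_val_def)

lemma wv_Cons [simp]: "wv (a # ws) = a \<otimes> wv ws"
  by (simp add: word_val_def)

lemma S_closed [simp]: "s \<in> S \<Longrightarrow> s \<in> carrier W"
  using S_carrier by blast

lemma wv_closed [simp]: "set ws \<subseteq> S \<Longrightarrow> wv ws \<in> carrier W"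
  by (induction ws) auto

lemma wv_append: "set us \<subseteq> S \<Longrightarrow> set vs \<subseteq> S \<Longrightarrow> wv (us @ vs) = wv us \<otimes> wv vs"
  by (induction us) (auto simp: m_assoc)

lemma S_mult_self [simp]: "s \<in> S \<Longrightarrow> s \<otimes> s = \<one>"
  using pow_ord_eq_1[of s] S_order[of s] by (simp add: numeral_2_eq_2)

lemma S_mult_cancel [simp]: "s \<in> S \<Longrightarrow> x \<in> carrier W \<Longrightarrow> s \<otimes> (s \<otimes> x) = x"
  by (simp flip: m_assoc)

lemma S_mult_cancel_right [simp]: "s \<in> S \<Longrightarrow> x \<in> carrier W \<Longrightarrow> x \<otimes> s \<otimes> s = x"
  by (simp add: m_assoc)

lemma S_inv [simp]: "s \<in> S \<Longrightarrow> inv s = s"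
  by (simp add: inv_equality)

lemma S_neq_one: "s \<in> S \<Longrightarrow> s \<noteq> \<one>"
  using S_order[of s] by auto

lemma wv_rev: "set ws \<subseteq> S \<Longrightarrow> wv (rev ws) = inv (wv ws)"
  by (induction ws) (auto simp: wv_append inv_mult_group)

text \<open>Inverses cost nothing, because every generator is its own inverse.\<close>

lemma generate_words:
  assumes "J \<subseteq> S"
  shows "x \<in> generate W J \<longleftrightarrow> (\<exists>ws. set ws \<subseteq> J \<and> wv ws = x)"
proof
  assume "x \<in> generate W J"
  then show "\<exists>ws. set ws \<subseteq> J \<and> wv ws = x"
  proof (induction rule: generate.induct)
    case one
    then show ?case by (intro exI[of _ "[]"]) auto
  next
    case (incl h)
    then show ?case using assms by (intro exI[of _ "[h]"]) auto
  next
    case (inv h)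
    then show ?case using assms by (intro exI[of _ "[h]"]) auto
  next
    case (eng h1 h2)
    then obtain us vs where "set us \<subseteq> J" "set vs \<subseteq> J" "wv us = h1" "wv vs = h2"
      by auto
    moreover have "set us \<subseteq> S" "set vs \<subseteq> S" using calculation assms by auto
    ultimately show ?case by (intro exI[of _ "us @ vs"]) (auto simp: wv_append)
  qed
next
  have "wv ws \<in> generate W J" if "set ws \<subseteq> J" for ws
    using that by (induction ws) (auto intro: generate.intros)
  then show "\<exists>ws. set ws \<subseteq> J \<and> wv ws = x \<Longrightarrow> x \<in> generate W J" by auto
qed

lemma ex_word: "w \<in> carrier W \<Longrightarrow> \<exists>ws. set ws \<subseteq> S \<and> wv ws = w"
  using generate_words[of S w] S_generates by auto

lemma len_eq: "len w = (LEAST n. \<exists>ws. set ws \<subseteq> S \<and> length ws = n \<and> wv ws = w)"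
  unfolding len_def Bex_def by (simp add: in_lists_conv_set subset_iff Ball_def)

lemma reduced_word_iff:
  "reduced_word w ws \<longleftrightarrow> set ws \<subseteq> S \<and> wv ws = w \<and> length ws = len w"
  by (auto simp: reduced_word_def in_lists_conv_set)

lemma wv_eq_iff:
  "set us \<subseteq> S \<Longrightarrow> set vs \<subseteq> S \<Longrightarrow>
    wv us = wv vs \<longleftrightarrow> equivclp (coxeter_step W S) us vs"
  by (rule S_presentation) auto

lemma len_wv_le: "set ws \<subseteq> S \<Longrightarrow> len (wv ws) \<le> length ws"
  unfolding len_eq by (rule Least_le) blast

lemma ex_reduced: "w \<in> carrier W \<Longrightarrow> \<exists>ws. reduced_word w ws"
proof -
  assume "w \<in> carrier W"
  then have "\<exists>n. \<exists>ws. set ws \<subseteq> S \<and> length ws = n \<and> wv ws = w" using ex_word by blast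
  then have "\<exists>ws. set ws \<subseteq> S \<and> length ws = len w \<and> wv ws = w"
    unfolding len_eq by (rule LeastI_ex)
  then show ?thesis by (auto simp: reduced_word_iff)
qed

lemma len_one [simp]: "len \<one> = 0"
  using len_wv_le[of "[]"] by simp

lemma len_eq_0 [simp]: "w \<in> carrier W \<Longrightarrow> len w = 0 \<longleftrightarrow> w = \<one>"
  using ex_reduced[of w] by (auto simp: reduced_word_iff)

lemma len_inv [simp]:
  assumes "w \<in> carrier W"
  shows "len (inv w) = len w"
proof -
  have *: "len (inv x) \<le> len x" if x: "x \<in> carrier W" for x
  proof -
    obtain ws where "reduced_word x ws" using ex_reduced[OF x] by blast
    then have "set ws \<subseteq> S" "wv ws = x" "length ws = len x" by (auto simp: reduced_word_iff)
    then show ?thesis using len_wv_le[of "rev ws"] wv_rev[of ws] by auto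
  qed
  show ?thesis using *[OF assms] *[of "inv w"] assms by simp
qed

text \<open>A relator has even length, so parity is an invariant of the value of a word. This sign
  character is what makes a generator change the length by exactly one.\<close>

lemma coxeter_step_even_length:
  "coxeter_step W S us vs \<Longrightarrow> even (length us) = even (length vs)"
  by (induction rule: coxeter_step.induct) (auto simp: length_concat sum_list_replicate)

lemma equiv_step_even_length:
  assumes "equivclp (coxeter_step W S) us vs"
  shows "even (length us) = even (length vs)"
  using assms by (induction rule: equivclp_induct) (auto dest: coxeter_step_even_length)

lemma even_len: "set ws \<subseteq> S \<Longrightarrow> even (len (wv ws)) = even (length ws)"
proof -
  assume ws: "set ws \<subseteq> S"
  then obtain us where us: "reduced_word (wv ws) us" using ex_reduced[of "wv ws"] by auto
  then have "equivclp (coxeter_step W S) us ws"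
    using wv_eq_iff[of us ws] ws by (auto simp: reduced_word_iff)
  then show ?thesis using equiv_step_even_length[of us ws] us by (auto simp: reduced_word_iff)
qed

lemma even_len_mult:
  assumes "x \<in> carrier W" "y \<in> carrier W"
  shows "even (len (x \<otimes> y)) = even (len x + len y)"
proof -
  obtain us vs where *: "set us \<subseteq> S" "wv us = x" "set vs \<subseteq> S" "wv vs = y"
    using ex_word assms by meson
  then show ?thesis
    using even_len[of "us @ vs"] even_len[of us] even_len[of vs] by (auto simp: wv_append)
qed

lemma len_mult_le:
  assumes "x \<in> carrier W" "y \<in> carrier W"
  shows "len (x \<otimes> y) \<le> len x + len y"
proof -
  obtain us vs where *: "reduced_word x us" "reduced_word y vs"
    using ex_reduced[OF assms(1)] ex_reduced[OF assms(2)] by blast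
  then show ?thesis
    using len_wv_le[of "us @ vs"] by (auto simp: wv_append reduced_word_iff)
qed

lemma len_S [simp]: "s \<in> S \<Longrightarrow> len s = 1"
  using len_wv_le[of "[s]"] len_eq_0[of s] S_neq_one[of s] by (simp del: len_eq_0)

lemma len_mult_S:
  assumes "w \<in> carrier W" "s \<in> S"
  shows "len (w \<otimes> s) = Suc (len w) \<or> len w = Suc (len (w \<otimes> s))"
proof -
  have "len (w \<otimes> s) \<le> len w + 1" using len_mult_le[of w s] assms by simp
  moreover have "len w \<le> len (w \<otimes> s) + 1" using len_mult_le[of "w \<otimes> s" s] assms by simp
  moreover have "even (len (w \<otimes> s)) \<noteq> even (len w)" using even_len_mult[of w s] assms by simp
  ultimately show ?thesis by presburger
qed

lemma len_S_mult:
  assumes "w \<in> carrier W" "s \<in> S"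
  shows "len (s \<otimes> w) = Suc (len w) \<or> len w = Suc (len (s \<otimes> w))"
proof -
  have "len (s \<otimes> w) = len (inv w \<otimes> s)"
    using len_inv[of "s \<otimes> w"] assms by (simp add: inv_mult_group del: len_inv)
  then show ?thesis using len_mult_S[of "inv w" s] assms by simp
qed

lemma ex_right_descent:
  assumes "w \<in> carrier W" "w \<noteq> \<one>"
  shows "\<exists>s\<in>S. len (w \<otimes> s) < len w"
proof -
  obtain ws where ws: "reduced_word w ws" using ex_reduced[OF assms(1)] by blast
  moreover have "ws \<noteq> []" using ws assms by (auto simp: reduced_word_iff)
  ultimately obtain us s where us: "ws = us @ [s]" by (metis rev_exhaust)
  then have *: "set us \<subseteq> S" "s \<in> S" "w = wv us \<otimes> s" "len w = Suc (length us)"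
    using ws by (auto simp: reduced_word_iff wv_append)
  then show ?thesis using len_wv_le[of us] by (intro bexI[of _ s]) auto
qed

lemma ex_left_descent:
  assumes "w \<in> carrier W" "w \<noteq> \<one>"
  shows "\<exists>s\<in>S. len (s \<otimes> w) < len w"
proof -
  obtain s where s: "s \<in> S" "len (inv w \<otimes> s) < len (inv w)"
    using ex_right_descent[of "inv w"] assms by auto
  then have "len (s \<otimes> w) < len w"
    using len_inv[of "s \<otimes> w"] assms by (simp add: inv_mult_group del: len_inv)
      (use assms in simp)
  then show ?thesis using s by blast
qed

end

subsection \<open>The geometric representation\<close>

definition basis_vec :: "'a \<Rightarrow> 'a \<Rightarrow> real" where
  "basis_vec s = (\<lambda>r. if r = s then 1 else 0)"

definition nonneg :: "('a \<Rightarrow> real) \<Rightarrow> bool" where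
  "nonneg v \<longleftrightarrow> (\<forall>r. 0 \<le> v r)"

lemma basis_vec_simps [simp]: "basis_vec s s = 1" "r \<noteq> s \<Longrightarrow> basis_vec s r = 0"
  by (simp_all add: basis_vec_def)

lemma nonneg_basis_vec [simp]: "nonneg (basis_vec s)"
  by (simp add: nonneg_def basis_vec_def)

text \<open>The word grows to the left: its last letter is always \<open>t\<close>, while its first
  letter depends on the parity of the length.\<close>

fun alternating :: "'a \<Rightarrow> 'a \<Rightarrow> nat \<Rightarrow> 'a list" where
  "alternating t s 0 = []"
| "alternating t s (Suc k) = (if even k then t else s) # alternating t s k"

lemma length_alternating [simp]: "length (alternating t s k) = k"
  by (induction k) auto

lemma set_alternating: "set (alternating t s k) \<subseteq> {s, t}"
  by (induction k) auto

lemma alternating_add: "alternating t s (j + k) =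
   (if even k then alternating t s j else alternating s t j) @ alternating t s k"
  by (induction j) auto

lemma alternating_even: "alternating t s (2 * k) = concat (replicate k [s, t])"
  by (induction k) auto

locale finite_coxeter_system = coxeter_system +
  assumes finite_carrier: "finite (carrier W)"
begin

lemma finite_S [simp]: "finite S"
  using finite_carrier S_carrier by (rule rev_finite_subset)

text \<open>\<open>W\<close> acts on the real vectors indexed by \<open>S\<close> by its geometric representation: the basis
  vectors are the simple roots, and \<open>bond s t\<close> is \<open>-2 B(\<alpha>\<^sub>s, \<alpha>\<^sub>t)\<close> off the diagonal.\<close>

definition bond :: "'a \<Rightarrow> 'a \<Rightarrow> real" where
  "bond s t = (if s = t \<or> s \<notin> S \<or> t \<notin> S then 0 else 2 * cos (pi / real (ord (s \<otimes> t))))"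

definition adj :: "('a \<Rightarrow> real) \<Rightarrow> 'a \<Rightarrow> real" where
  "adj v r = (\<Sum>t\<in>S. bond r t * v t)"

text \<open>In coordinates \<open>2 B(\<alpha>\<^sub>s, v)\<close> is
  \<open>2 * v s - adj v s\<close>, so subtracting that multiple of the simple root alters the
  coordinate \<open>s\<close> only.\<close>

definition reflect :: "'a \<Rightarrow> ('a \<Rightarrow> real) \<Rightarrow> 'a \<Rightarrow> real" where
  "reflect s v = v(s := adj v s - v s)"

definition act_word :: "'a list \<Rightarrow> ('a \<Rightarrow> real) \<Rightarrow> 'a \<Rightarrow> real" where
  "act_word ws = foldr reflect ws"

lemma act_word_Nil [simp]: "act_word [] v = v"
  by (simp add: act_word_def)

lemma act_word_Cons [simp]: "act_word (a # ws) v = reflect a (act_word ws v)"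
  by (simp add: act_word_def)

lemma act_word_append [simp]: "act_word (us @ vs) v = act_word us (act_word vs v)"
  by (simp add: act_word_def)

lemma bond_self [simp]: "bond s s = 0"
  by (simp add: bond_def)

lemma ord_S_sym: "s \<in> S \<Longrightarrow> t \<in> S \<Longrightarrow> ord (s \<otimes> t) = ord (t \<otimes> s)"
  using ord_inv[of "s \<otimes> t"] by (simp add: inv_mult_group)

lemma bond_sym: "bond s t = bond t s"
  by (auto simp: bond_def ord_S_sym)

lemma ord_S_ge_2:
  assumes "s \<in> S" "t \<in> S" "s \<noteq> t"
  shows "ord (s \<otimes> t) \<ge> 2"
proof -
  have "ord (s \<otimes> t) \<noteq> 0" using assms ord_ge_1[of "s \<otimes> t"] finite_carrier by simp
  moreover have "ord (s \<otimes> t) \<noteq> 1"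
  proof
    assume "ord (s \<otimes> t) = 1"
    then have "s \<otimes> t = \<one>" using assms ord_eq_1 by simp
    then have "inv t = s" using assms by (intro inv_equality) auto
    then show False using assms by simp
  qed
  ultimately show ?thesis by linarith
qed

lemma bond_nonneg: "0 \<le> bond s t"
proof (cases "s = t \<or> s \<notin> S \<or> t \<notin> S")
  case False
  then have "pi / real (ord (s \<otimes> t)) \<le> pi / 2"
    using ord_S_ge_2[of s t] by (intro divide_left_mono) auto
  moreover have "- (pi / 2) \<le> 0" "0 \<le> pi / real (ord (s \<otimes> t))" by simp_all
  ultimately have "0 \<le> cos (pi / real (ord (s \<otimes> t)))"
    by (intro cos_ge_zero) linarith+
  then show ?thesis by (simp add: bond_def)
qed (auto simp: bond_def)

text \<open>A nonzero bond has order at least 3, and 2 cos(pi/3) = 1. This gap lets a bound on a sum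
  of bonds count neighbours.\<close>

lemma bond_ge_1:
  assumes "bond s t \<noteq> 0"
  shows "1 \<le> bond s t"
proof -
  have st: "s \<noteq> t" "s \<in> S" "t \<in> S" using assms by (auto simp: bond_def split: if_splits)
  then have "ord (s \<otimes> t) \<noteq> 2" using assms by (auto simp: bond_def)
  then have "pi / real (ord (s \<otimes> t)) \<le> pi / 3"
    using ord_S_ge_2[of s t] st by (intro divide_left_mono) auto
  then have "cos (pi / 3) \<le> cos (pi / real (ord (s \<otimes> t)))"
    by (intro cos_monotone_0_pi_le) auto
  then show ?thesis using st by (simp add: bond_def cos_60)
qed

text \<open>The cosine vanishes exactly for order 2, and two distinct involutions commute exactly
  when their product has order 2.\<close>

lemma bond_eq_0_iff_commute:
  assumes "s \<in> S" "t \<in> S"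
  shows "bond s t = 0 \<longleftrightarrow> s \<otimes> t = t \<otimes> s"
proof (cases "s = t")
  case False
  have "bond s t = 0 \<longleftrightarrow> ord (s \<otimes> t) = 2"
  proof
    show "ord (s \<otimes> t) = 2 \<Longrightarrow> bond s t = 0" by (simp add: bond_def)
  next
    assume 0: "bond s t = 0"
    show "ord (s \<otimes> t) = 2"
    proof (rule ccontr)
      assume "ord (s \<otimes> t) \<noteq> 2"
      then have "pi / real (ord (s \<otimes> t)) < pi / 2"
        using ord_S_ge_2[of s t] assms False by (intro divide_strict_left_mono) auto
      moreover have "- (pi / 2) < 0" "0 \<le> pi / real (ord (s \<otimes> t))" by simp_all
      ultimately have "0 < cos (pi / real (ord (s \<otimes> t)))"
        by (intro cos_gt_zero_pi) linarith+
      then show False using 0 assms False by (simp add: bond_def)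
    qed
  qed
  also have "\<dots> \<longleftrightarrow> (s \<otimes> t) \<otimes> (s \<otimes> t) = \<one>"
  proof
    assume "ord (s \<otimes> t) = 2"
    then show "(s \<otimes> t) \<otimes> (s \<otimes> t) = \<one>"
      using pow_ord_eq_1[of "s \<otimes> t"] assms by (simp add: numeral_2_eq_2)
  next
    assume "(s \<otimes> t) \<otimes> (s \<otimes> t) = \<one>"
    then have "(s \<otimes> t) [^] (2::nat) = \<one>" using assms by (simp add: numeral_2_eq_2)
    then have "ord (s \<otimes> t) dvd 2" using assms pow_eq_id by simp
    then show "ord (s \<otimes> t) = 2" using ord_S_ge_2[OF assms False] by (auto dest!: dvd_imp_le)
  qed
  also have "\<dots> \<longleftrightarrow> s \<otimes> t = t \<otimes> s"
  proof
    assume "(s \<otimes> t) \<otimes> (s \<otimes> t) = \<one>"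
    then have "inv (s \<otimes> t) = s \<otimes> t" using assms by (intro inv_equality) auto
    then show "s \<otimes> t = t \<otimes> s" using assms by (simp add: inv_mult_group)
  next
    assume *: "s \<otimes> t = t \<otimes> s"
    have "(s \<otimes> t) \<otimes> (s \<otimes> t) = (t \<otimes> s) \<otimes> (s \<otimes> t)" using * by simp
    then show "(s \<otimes> t) \<otimes> (s \<otimes> t) = \<one>" using assms by (simp add: m_assoc)
  qed
  finally show ?thesis .
qed simp

lemma adj_cong: "(\<And>r. r \<in> S \<Longrightarrow> bond s r \<noteq> 0 \<Longrightarrow> u r = v r) \<Longrightarrow> adj u s = adj v s"
  unfolding adj_def by (rule sum.cong, simp, metis mult_zero_left)

lemma adj_add: "adj (\<lambda>r. u r + v r) = (\<lambda>r. adj u r + adj v r)"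
  by (auto simp: adj_def sum.distrib algebra_simps)

lemma adj_diff: "adj (\<lambda>r. u r - v r) = (\<lambda>r. adj u r - adj v r)"
  by (auto simp: adj_def sum_subtractf algebra_simps)

lemma adj_scale: "adj (\<lambda>r. c * v r) = (\<lambda>r. c * adj v r)"
  by (auto simp: adj_def sum_distrib_left algebra_simps)

lemma adj_basis: "t \<in> S \<Longrightarrow> adj (basis_vec t) s = bond s t"
  by (simp add: adj_def basis_vec_def if_distrib cong: if_cong)

lemma reflect_involution [simp]: "reflect s (reflect s v) = v"
proof -
  have "adj (reflect s v) s = adj v s"
    by (rule adj_cong) (auto simp: reflect_def)
  then show ?thesis by (auto simp: reflect_def)
qed

lemma reflect_add: "reflect s (\<lambda>r. u r + v r) = (\<lambda>r. reflect s u r + reflect s v r)"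
  by (auto simp: reflect_def adj_add)

lemma reflect_scale: "reflect s (\<lambda>r. c * v r) = (\<lambda>r. c * reflect s v r)"
  by (auto simp: reflect_def adj_scale algebra_simps)

lemma reflect_basis: "s \<in> S \<Longrightarrow> reflect s (basis_vec s) = (\<lambda>r. - basis_vec s r)"
  by (auto simp: reflect_def adj_basis)

lemma adj_fun_upd2:
  assumes "s \<in> S" "t \<in> S" "s \<noteq> t"
  shows "adj (v(s := x, t := y)) s = bond s t * y + (\<Sum>r\<in>S - {s, t}. bond s r * v r)"
proof -
  have "adj (v(s := x, t := y)) s =
    (\<Sum>r\<in>insert s (insert t (S - {s, t})). bond s r * (v(s := x, t := y)) r)"
    unfolding adj_def using assms by (intro sum.cong) auto
  also have "\<dots> = bond s t * y + (\<Sum>r\<in>S - {s, t}. bond s r * (v(s := x, t := y)) r)"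
    using assms by (subst sum.insert; simp)+
  also have "(\<Sum>r\<in>S - {s, t}. bond s r * (v(s := x, t := y)) r) = (\<Sum>r\<in>S - {s, t}. bond s r * v r)"
    by (intro sum.cong) auto
  finally show ?thesis .
qed

text \<open>On the coordinates \<open>s\<close>, \<open>t\<close> the product of the two reflections is an affine map with
  fixed point \<open>(cx, cy)\<close> and linear part a rotation by \<open>2\<theta>\<close>.\<close>

lemma reflect_reflect_power:
  assumes st: "s \<in> S" "t \<in> S" "s \<noteq> t" and m: "m = ord (s \<otimes> t)"
  shows "((\<lambda>v. reflect s (reflect t v)) ^^ m) v = v"
proof -
  define \<theta> where "\<theta> = pi / real m"
  define b where "b p q = (\<Sum>r\<in>S - {p, q}. bond p r * v r)" for p q
  define a where "a = bond s t"
  have m2: "m \<ge> 2" using ord_S_ge_2 st m by simp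
  have a: "a = 2 * cos \<theta>" using st by (simp add: a_def bond_def m \<theta>_def)
  have \<theta>: "0 < \<theta>" "\<theta> < pi" using m2 by (auto simp: \<theta>_def field_simps)
  then have sin: "sin \<theta> > 0" by (rule sin_gt_zero)
  have "a\<^sup>2 = 4 - 4 * (sin \<theta>)\<^sup>2" by (simp add: a power_mult_distrib cos_squared_eq)
  then have d: "4 - a\<^sup>2 \<noteq> 0" using sin by simp
  \<comment> \<open>Cramer's rule for the fixed point; the determinant \<open>4 - a\<^sup>2\<close>
    is four times the squared sine of the angle.\<close>
  define cx where "cx = (a * b t s + 2 * b s t) / (4 - a\<^sup>2)"
  define cy where "cy = (a * b s t + 2 * b t s) / (4 - a\<^sup>2)"
  have cx: "2 * cx = a * cy + b s t" and cy: "2 * cy = a * cx + b t s"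
    using d by (auto simp: cx_def cy_def field_simps power2_eq_square)
  define p q where "p = v s - cx" and "q = v t - cy"
  \<comment> \<open>The solution of the recurrence with characteristic coefficient \<open>a\<close>
    that takes the values \<open>q\<close> at -1 and \<open>p\<close> at 0. Each single reflection
    replaces one coordinate by the next value of \<open>f\<close>, so m double steps shift the angle
    by a full period.\<close>
  define f where "f k = p / sin \<theta> * sin ((k + 1) * \<theta>) - q / sin \<theta> * sin (k * \<theta>)" for k :: real
  have f_rec: "f (k + 2) = a * f (k + 1) - f k" for k
  proof -
    have *: "sin ((j + 2) * \<theta>) = a * sin ((j + 1) * \<theta>) - sin (j * \<theta>)" for j
    proof -
      have "sin ((j + 1) * \<theta> + \<theta>) + sin ((j + 1) * \<theta> - \<theta>) = a * sin ((j + 1) * \<theta>)"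
        by (simp add: sin_add sin_diff a)
      then show ?thesis by (simp add: algebra_simps)
    qed
    have e: "k + 2 + 1 = (k + 1) + 2" by simp
    show ?thesis
      unfolding f_def e * by (simp add: right_diff_distrib mult.left_commute)
  qed
  have step: "reflect s (reflect t (v(s := cx + y0, t := cy + y1))) =
      v(s := cx + (a * (a * y0 - y1) - y0), t := cy + (a * y0 - y1))" for y0 y1
  proof -
    have 1: "reflect t (v(s := cx + y0, t := cy + y1)) = v(s := cx + y0, t := cy + (a * y0 - y1))"
    proof -
      have "adj (v(s := cx + y0, t := cy + y1)) t = a * (cx + y0) + b t s"
        using adj_fun_upd2[of t s v "cy + y1" "cx + y0"] st
        by (simp add: fun_upd_twist b_def a_def bond_sym[of t s] del: fun_upd_apply)
      then show ?thesis using cy by (auto simp: reflect_def fun_eq_iff algebra_simps)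
    qed
    have "adj (v(s := cx + y0, t := cy + (a * y0 - y1))) s = a * (cy + (a * y0 - y1)) + b s t"
      using adj_fun_upd2[of s t v] st by (simp add: b_def a_def del: fun_upd_apply)
    then show ?thesis unfolding 1 using cx st
      by (auto simp: reflect_def fun_eq_iff algebra_simps)
  qed
  have "((\<lambda>v. reflect s (reflect t v)) ^^ n) v = v(s := cx + f (2 * real n), t := cy + f (2 * real n - 1))" for n
  proof (induction n)
    case 0
    have "f 0 = p" "f (-1) = q" using sin by (auto simp: f_def)
    then show ?case by (auto simp: p_def q_def)
  next
    case (Suc n)
    have 1: "f (2 * real n + 1) = a * f (2 * real n) - f (2 * real n - 1)"
      using f_rec[of "2 * real n - 1"] by (simp add: algebra_simps)
    have 2: "f (2 * real n + 2) = a * f (2 * real n + 1) - f (2 * real n)"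
      using f_rec[of "2 * real n"] by simp
    have e: "2 * real (Suc n) = 2 * real n + 2" "2 * real n + 2 - 1 = 2 * real n + 1" by auto
    show ?case using Suc step by (simp only: funpow.simps o_apply e 1 2)
  qed
  note power = this
  have "2 * real m * \<theta> = 2 * pi" using m2 by (simp add: \<theta>_def)
  then have "(2 * real m + 1) * \<theta> = \<theta> + 2 * pi" "(2 * real m - 1) * \<theta> = - \<theta> + 2 * pi"
    by (auto simp: algebra_simps)
  moreover have "sin (2 * real m * \<theta>) = 0" unfolding \<open>2 * real m * \<theta> = 2 * pi\<close> by simp
  ultimately have "f (2 * real m) = p" "f (2 * real m - 1) = q"
    using sin unfolding f_def by simp_all
  then show ?thesis by (auto simp: power p_def q_def)
qed

lemma act_word_relator:
  assumes "s \<in> S" "t \<in> S"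
  shows "act_word (concat (replicate (ord (s \<otimes> t)) [s, t])) v = v"
proof -
  have *: "act_word (concat (replicate n [s, t])) v = ((\<lambda>v. reflect s (reflect t v)) ^^ n) v" for n
    by (induction n) auto
  show ?thesis
  proof (cases "s = t")
    case True
    then show ?thesis using assms by simp
  next
    case False
    then show ?thesis using * reflect_reflect_power[of s t] assms by simp
  qed
qed

text \<open>Relators act trivially, so inserting or deleting them leaves the action unchanged; by
  the presentation this connects any two words of equal value, and the action descends to the
  group.\<close>

lemma act_word_cong:
  assumes "set us \<subseteq> S" "set vs \<subseteq> S" "wv us = wv vs"
  shows "act_word us = act_word vs"
proof -
  have one_step: "act_word us = act_word vs" if "coxeter_step W S us vs" for us vs
    using that by (induction rule: coxeter_step.induct) (auto simp: act_word_relator fun_eq_iff)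
  have "equivclp (coxeter_step W S) us vs" using assms wv_eq_iff by blast
  then show ?thesis
  proof (induction rule: equivclp_induct)
    case (step y z)
    then show ?case using one_step by metis
  qed simp
qed

definition act :: "'a \<Rightarrow> ('a \<Rightarrow> real) \<Rightarrow> 'a \<Rightarrow> real" where
  "act w = act_word (SOME ws. set ws \<subseteq> S \<and> wv ws = w)"

lemma act_wv: "set ws \<subseteq> S \<Longrightarrow> act (wv ws) = act_word ws"
proof -
  assume ws: "set ws \<subseteq> S"
  then have "\<exists>us. set us \<subseteq> S \<and> wv us = wv ws" by blast
  then have "set (SOME us. set us \<subseteq> S \<and> wv us = wv ws) \<subseteq> S \<and>
      wv (SOME us. set us \<subseteq> S \<and> wv us = wv ws) = wv ws"
    by (rule someI_ex)
  then show ?thesis unfolding act_def using ws act_word_cong by blast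
qed

lemma act_one [simp]: "act \<one> v = v"
  using act_wv[of "[]"] by simp

lemma act_S [simp]: "s \<in> S \<Longrightarrow> act s = reflect s"
  using act_wv[of "[s]"] by (simp add: fun_eq_iff)

lemma act_mult:
  assumes "x \<in> carrier W" "y \<in> carrier W"
  shows "act (x \<otimes> y) v = act x (act y v)"
proof -
  obtain us vs where *: "set us \<subseteq> S" "wv us = x" "set vs \<subseteq> S" "wv vs = y"
    using ex_word[OF assms(1)] ex_word[OF assms(2)] by blast
  then have "act (wv (us @ vs)) = act_word (us @ vs)" by (intro act_wv) auto
  then show ?thesis using * act_wv[of us] act_wv[of vs] by (auto simp: wv_append)
qed

lemma act_inv [simp]: "x \<in> carrier W \<Longrightarrow> act (inv x) (act x v) = v"
    and act_inv' [simp]: "x \<in> carrier W \<Longrightarrow> act x (act (inv x) v) = v"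
  by (simp_all flip: act_mult)

lemma act_word_add: "act_word ws (\<lambda>r. u r + v r) = (\<lambda>r. act_word ws u r + act_word ws v r)"
  by (induction ws) (auto simp: reflect_add)

lemma act_add: "act w (\<lambda>r. u r + v r) = (\<lambda>r. act w u r + act w v r)"
  unfolding act_def by (rule act_word_add)

lemma act_word_scale: "act_word ws (\<lambda>r. c * v r) = (\<lambda>r. c * act_word ws v r)"
  by (induction ws) (auto simp: reflect_scale)

lemma act_scale: "act w (\<lambda>r. c * v r) = (\<lambda>r. c * act w v r)"
  unfolding act_def by (rule act_word_scale)

lemma act_uminus: "act w (\<lambda>r. - v r) = (\<lambda>r. - act w v r)"
  using act_scale[of w "-1" v] by simp

lemma act_word_other:
  "r \<notin> set ws \<Longrightarrow> act_word ws v r = v r"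
  by (induction ws) (auto simp: reflect_def)

end

subsection \<open>Signs of roots and strong exchange\<close>

lemma alternating_snoc: "alternating t s (Suc k) = alternating s t k @ [t]"
  using alternating_add[of t s k 1] by simp

lemma rev_alternating:
  "rev (alternating t s k) = (if even k then alternating s t k else alternating t s k)"
proof (induction k arbitrary: s t)
  case (Suc k)
  have "rev (alternating t s (Suc k)) = t # rev (alternating s t k)"
    by (simp only: alternating_snoc rev_append rev.simps append.simps)
  then show ?case using Suc by simp
qed simp

context finite_coxeter_system
begin

lemma inv_mult_cancel: "x \<in> carrier W \<Longrightarrow> y \<in> carrier W \<Longrightarrow> inv x \<otimes> (x \<otimes> y) = y"
  by (simp flip: m_assoc)

text \<open>The braid relation: cut the trivial alternating word of length 2m in the middle. Its
  left half is the reversal, hence the inverse, of the other alternating word.\<close>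

lemma wv_alternating_eq:
  assumes st: "s \<in> S" "t \<in> S" and m: "m = ord (s \<otimes> t)"
  shows "wv (alternating t s m) = wv (alternating s t m)"
proof -
  have sub: "set (alternating t s m) \<subseteq> S" "set (alternating s t m) \<subseteq> S"
    using set_alternating[of t s m] set_alternating[of s t m] st by auto
  have pow: "wv (concat (replicate n [s, t])) = (s \<otimes> t) [^] n" for n
  proof (induction n)
    case (Suc n)
    have "(s \<otimes> t) [^] Suc n = (s \<otimes> t) \<otimes> (s \<otimes> t) [^] n"
      using st by (intro nat_pow_Suc2) simp
    then show ?case using Suc st by (simp add: m_assoc)
  qed simp
  have "\<one> = wv (alternating t s (m + m))"
    using pow[of m] alternating_even[of t s m] st by (simp add: m mult_2)
  also have "\<dots> = wv (rev (alternating s t m)) \<otimes> wv (alternating t s m)"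
    using sub by (simp add: alternating_add rev_alternating wv_append)
  finally have "inv (wv (alternating t s m)) = inv (wv (alternating s t m))"
    using sub by (intro inv_equality) (auto simp: wv_rev)
  then show ?thesis using sub by (metis inv_inv wv_closed in_lists_conv_set subset_code(1))
qed

lemma reflect_combination:
  assumes "s \<in> S" "t \<in> S" "s \<noteq> t"
  shows "reflect t (\<lambda>r. x * basis_vec s r + y * basis_vec t r) =
    (\<lambda>r. x * basis_vec s r + (bond s t * x - y) * basis_vec t r)"
  using assms by (auto simp: reflect_def adj_add adj_scale adj_basis bond_sym[of t s] fun_eq_iff)

text \<open>In the dihedral plane the coefficients obey the Chebyshev recurrence, so they are
  quotients of sines, nonnegative as long as the index is at most m.\<close>

lemma act_alternating:
  fixes \<theta> :: real
  assumes st: "s \<in> S" "t \<in> S" "s \<noteq> t" and \<theta>: "\<theta> = pi / real (ord (s \<otimes> t))"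
  defines "u \<equiv> \<lambda>k::nat. sin (real k * \<theta>) / sin \<theta>"
  shows "act_word (alternating t s k) (basis_vec s) =
    (\<lambda>r. u (if even k then Suc k else k) * basis_vec s r + u (if even k then k else Suc k) * basis_vec t r)"
proof (induction k)
  case 0
  have "0 < \<theta>" "\<theta> < pi" using ord_S_ge_2[OF st] by (auto simp: \<theta> field_simps)
  then have "sin \<theta> > 0" by (rule sin_gt_zero)
  then show ?case by (simp add: u_def)
next
  case (Suc k)
  have u: "u (Suc (Suc k)) = bond s t * u (Suc k) - u k"
  proof -
    have "sin (real (Suc k) * \<theta> + \<theta>) + sin (real (Suc k) * \<theta> - \<theta>) = bond s t * sin (real (Suc k) * \<theta>)"
      using st by (simp add: bond_def \<theta> sin_add sin_diff)
    then have "sin (real (Suc (Suc k)) * \<theta>) = bond s t * sin (real (Suc k) * \<theta>) - sin (real k * \<theta>)"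
      by (simp add: algebra_simps)
    then show ?thesis by (simp add: u_def diff_divide_distrib)
  qed
  show ?case
  proof (cases "even k")
    case True
    then show ?thesis using Suc u reflect_combination[OF st] by simp
  next
    case False
    then show ?thesis using Suc u reflect_combination[of t s "u (Suc k)" "u k"] st
      by (simp add: bond_sym[of t s] add.commute)
  qed
qed

text \<open>Strip from the right of \<open>w\<close> as long an alternating word in \<open>s\<close>
  and a descent \<open>t\<close> as possible. The remaining factor \<open>v\<close> lengthens with
  both letters, so induction applies to both of its roots, and the dihedral formula combines them
  with nonnegative coefficients.\<close>

theorem nonneg_root:
  assumes "w \<in> carrier W" "s \<in> S" "len w < len (w \<otimes> s)"
  shows "nonneg (act w (basis_vec s))"
  using assms
proof (induction "len w" arbitrary: w s rule: less_induct)
  case less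
  show ?case
  proof (cases "w = \<one>")
    case False
    then obtain t where t: "t \<in> S" "len (w \<otimes> t) < len w" using ex_right_descent less by blast
    have s: "s \<in> S" and w: "w \<in> carrier W" using less by auto
    have st: "s \<noteq> t" using t less by auto
    define m where "m = ord (s \<otimes> t)"
    \<comment> \<open>\<open>P k\<close> says that cancelling the alternating word of length
      \<open>k\<close> from the right end lowers the length by \<open>k\<close>.\<close>
    define P where "P k \<longleftrightarrow> len (w \<otimes> inv (wv (alternating t s k))) + k = len w" for k
    have sub: "set (alternating t s k) \<subseteq> S" for k
      using set_alternating[of t s k] s t by auto
    have P1: "P 1" using t w len_mult_S[OF w t(1)] by (auto simp: P_def)
    \<comment> \<open>Otherwise \<open>P\<close> would persist beyond the length of
      \<open>w\<close>.\<close>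
    have "\<exists>K\<ge>1. P K \<and> \<not> P (Suc K)"
    proof (rule ccontr)
      assume "\<not> ?thesis"
      then have "P (Suc k)" for k using P1 by (induction k) auto
      from this[of "len w"] show False by (simp add: P_def)
    qed
    then obtain K where K: "K \<ge> 1" "P K" "\<not> P (Suc K)" by blast
    define v where "v = w \<otimes> inv (wv (alternating t s K))"
    have v: "v \<in> carrier W" using w sub by (simp add: v_def)
    have w_eq: "w = v \<otimes> wv (alternating t s K)" using w sub by (simp add: v_def m_assoc)
    have len_w: "len w = len v + K" using K by (simp add: P_def v_def)
    \<comment> \<open>\<open>z\<close> is the letter that could not be stripped next,
      \<open>z'\<close> the one stripped last. Both lengthen \<open>v\<close>: the first by
      maximality of \<open>K\<close>, the second because otherwise \<open>w\<close> would be too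
      short.\<close>
    define z where "z = (if even K then t else s)"
    define z' where "z' = (if even K then s else t)"
    have z: "z \<in> S" "z' \<in> S" using s t by (auto simp: z_def z'_def)
    have "w \<otimes> inv (wv (alternating t s (Suc K))) = v \<otimes> z"
      using sub[of K] z w by (simp add: v_def inv_mult_group m_assoc flip: z_def)
    then have "len (v \<otimes> z) + Suc K \<noteq> len w" using K by (simp add: P_def)
    then have vz: "len v < len (v \<otimes> z)" using len_mult_S[OF v z(1)] len_w by linarith
    obtain K' where K': "K = Suc K'" using K by (cases K) auto
    have "alternating t s K = z' # alternating t s K'" by (simp add: K' z'_def)
    then have "w = (v \<otimes> z') \<otimes> wv (alternating t s K')"
      using w_eq v z sub[of K'] by (simp add: m_assoc)
    then have "len w \<le> len (v \<otimes> z') + K'"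
      using len_mult_le[of "v \<otimes> z'" "wv (alternating t s K')"] len_wv_le[OF sub[of K']] v z sub[of K']
      by simp
    then have vz': "len v < len (v \<otimes> z')" using len_w K' by simp
    have vst: "len v < len (v \<otimes> s)" "len v < len (v \<otimes> t)"
      using vz vz' by (auto simp: z_def z'_def split: if_splits)
    have nn: "nonneg (act v (basis_vec s))" "nonneg (act v (basis_vec t))"
      using less(1)[of v] v s t vst len_w K by auto
    \<comment> \<open>With m or more letters the braid relation would produce an expression of
      \<open>w\<close> ending in \<open>s\<close>, so that \<open>w \<otimes> s\<close> would be
      shorter than \<open>w\<close>. This bound keeps both sine coefficients nonnegative.\<close>
    have "K < m"
    proof (rule ccontr)
      assume "\<not> K < m"
      then obtain j where j: "K = j + m" by (metis add.commute le_Suc_ex not_less)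
      have "m \<noteq> 0" using ord_S_ge_2[of s t] s t st by (simp add: m_def)
      then obtain m' where m': "m = Suc m'" by (cases m) auto
      define xs where "xs = (if even m then alternating t s j else alternating s t j)"
      have xs: "set xs \<subseteq> S" "length xs = j"
        using sub[of j] set_alternating[of s t j] s t by (auto simp: xs_def)
      have sub': "set (alternating s t m) \<subseteq> S" using set_alternating[of s t m] s t by auto
      have "alternating t s K = xs @ alternating t s m"
        by (simp add: j alternating_add xs_def)
      then have "wv (alternating t s K) = wv xs \<otimes> wv (alternating s t m)"
        using xs sub[of m] wv_alternating_eq[of s t m] s t by (simp add: wv_append m_def)
      also have "\<dots> = wv xs \<otimes> (wv (alternating t s m') \<otimes> s)"
        using s t sub[of m'] unfolding m' alternating_snoc by (simp add: wv_append)
      finally have "w \<otimes> s = v \<otimes> wv (xs @ alternating t s m')"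
        using w_eq v xs sub[of m'] s by (simp add: m_assoc wv_append)
      then have "len (w \<otimes> s) \<le> len v + (j + m')"
        using len_mult_le[of v "wv (xs @ alternating t s m')"] v xs sub[of m']
          len_wv_le[of "xs @ alternating t s m'"] by simp
      then show False using less(4) len_w j m' by simp
    qed
    define \<theta> where "\<theta> = pi / real m"
    have sin_nonneg: "0 \<le> sin (real k * \<theta>) / sin \<theta>" if "k \<le> m" for k
    proof -
      have "m > 0" using \<open>K < m\<close> by simp
      then have "0 \<le> real k * \<theta>" "real k * \<theta> \<le> pi" "0 \<le> \<theta>" "\<theta> \<le> pi"
        using that by (auto simp: \<theta>_def field_simps)
      then show ?thesis by (intro divide_nonneg_nonneg sin_ge_zero)
    qed
    obtain p q where pq: "act_word (alternating t s K) (basis_vec s) =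
        (\<lambda>r. p * basis_vec s r + q * basis_vec t r)" "0 \<le> p" "0 \<le> q"
      by (rule that[OF act_alternating[OF s t(1) st \<theta>_def[unfolded m_def], of K]])
        (use sin_nonneg[of K] sin_nonneg[of "Suc K"] \<open>K < m\<close> in simp_all)
    have "act w (basis_vec s) = act v (act_word (alternating t s K) (basis_vec s))"
      unfolding w_eq using v sub by (simp add: act_mult act_wv)
    also have "\<dots> = (\<lambda>r. p * act v (basis_vec s) r + q * act v (basis_vec t) r)"
      by (simp only: pq act_add act_scale)
    finally show ?thesis using nn pq by (simp add: nonneg_def)
  qed simp
qed

lemma act_word_uminus: "act_word ws (\<lambda>r. - v r) = (\<lambda>r. - act_word ws v r)"
  using act_word_scale[of ws "-1" v] by simp

lemma act_mult_S_basis: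
  "w \<in> carrier W \<Longrightarrow> s \<in> S \<Longrightarrow> act (w \<otimes> s) (basis_vec s) = (\<lambda>r. - act w (basis_vec s) r)"
  by (simp add: act_mult reflect_basis act_uminus)

lemma nonpos_root:
  assumes "w \<in> carrier W" "s \<in> S" "len (w \<otimes> s) < len w"
  shows "act w (basis_vec s) r \<le> 0"
proof -
  have "nonneg (act (w \<otimes> s) (basis_vec s))" using assms by (intro nonneg_root) auto
  then show ?thesis using assms by (simp add: act_mult_S_basis nonneg_def)
qed

lemma act_zero: "act w (\<lambda>r. 0) = (\<lambda>r. 0)"
  using act_scale[of w 0 "\<lambda>r. 0"] by simp

lemma root_nonzero:
  assumes "w \<in> carrier W" "s \<in> S"
  shows "\<exists>r. act w (basis_vec s) r \<noteq> 0"
proof (rule ccontr)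
  assume "\<not> ?thesis"
  then have "act w (basis_vec s) = (\<lambda>r. 0)" by auto
  then have "basis_vec s = (\<lambda>r. 0)" using act_inv[OF assms(1), of "basis_vec s"] by (simp add: act_zero)
  then show False by (metis basis_vec_simps(1) zero_neq_one)
qed

lemma nonneg_root_iff:
  assumes "w \<in> carrier W" "s \<in> S"
  shows "nonneg (act w (basis_vec s)) \<longleftrightarrow> len w < len (w \<otimes> s)"
proof
  assume nn: "nonneg (act w (basis_vec s))"
  show "len w < len (w \<otimes> s)"
  proof (rule ccontr)
    assume "\<not> ?thesis"
    then have "len (w \<otimes> s) < len w" using len_mult_S[OF assms] by auto
    then have "act w (basis_vec s) r = 0" for r
      using nonpos_root[OF assms, of r] nn by (auto simp: nonneg_def intro: antisym)
    then show False using root_nonzero[OF assms] by auto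
  qed
qed (use nonneg_root assms in blast)

lemma root_sign:
  assumes "w \<in> carrier W" "s \<in> S" "\<not> nonneg (act w (basis_vec s))"
  shows "act w (basis_vec s) r \<le> 0"
  using assms nonneg_root_iff[of w s] nonpos_root[of w s r] len_mult_S[of w s] by auto

text \<open>A nontrivial element has a right descent, and its root there is negative.\<close>

lemma eq_one_of_nonneg_roots:
  assumes "w \<in> carrier W" "\<And>s. s \<in> S \<Longrightarrow> nonneg (act w (basis_vec s))"
  shows "w = \<one>"
  using ex_right_descent[OF assms(1)] nonneg_root_iff[OF assms(1)] assms(2) by (meson not_less_iff_gr_or_eq)

lemma act_faithful:
  assumes "x \<in> carrier W" "y \<in> carrier W" "\<And>s. s \<in> S \<Longrightarrow> act x (basis_vec s) = act y (basis_vec s)"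
  shows "x = y"
proof -
  have "inv y \<otimes> x = \<one>"
  proof (rule eq_one_of_nonneg_roots)
    fix s assume "s \<in> S"
    then show "nonneg (act (inv y \<otimes> x) (basis_vec s))" using assms by (simp add: act_mult)
  qed (use assms in simp)
  then have "inv (inv y) = x" using assms by (intro inv_equality) (auto, metis inv_closed inv_comm)
  then show ?thesis using assms by simp
qed

section \<open>Reflections and the exchange condition\<close>

lemma act_reflection:
  assumes "x \<in> carrier W" "s \<in> S"
  shows "act (x \<otimes> s \<otimes> inv x) v =
    (\<lambda>r. v r + (adj (act (inv x) v) s - 2 * act (inv x) v s) * act x (basis_vec s) r)"
proof -
  define u where "u = act (inv x) v"
  have "reflect s u = (\<lambda>r. u r + (adj u s - 2 * u s) * basis_vec s r)"
    by (auto simp: reflect_def basis_vec_def)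
  moreover have "act (x \<otimes> s \<otimes> inv x) v = act x (reflect s u)"
    using assms by (simp add: act_mult u_def)
  ultimately show ?thesis using assms by (simp add: act_add act_scale u_def)
qed

text \<open>Both the reflection and \<open>a\<close> negate the simple root of \<open>a\<close> and
  change other vectors only in the coordinate \<open>a\<close>. Their product therefore fixes that
  root and keeps the coordinate \<open>r\<close> of every other simple root equal to 1; by the
  dichotomy of signs all its roots are nonnegative, so it is the identity.\<close>

lemma reflection_eq_of_root_proportional:
  assumes x: "x \<in> carrier W" "s \<in> S" and a: "a \<in> S"
    and root: "act x (basis_vec s) = (\<lambda>r. c * basis_vec a r)"
  shows "x \<otimes> s \<otimes> inv x = a"
proof -
  define g where "g = x \<otimes> s \<otimes> inv x"
  have g: "g \<in> carrier W" using x by (simp add: g_def)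
  have "c \<noteq> 0" using root_nonzero[OF x] root by auto
  have "act g (act x (basis_vec s)) = (\<lambda>r. - act x (basis_vec s) r)"
    using x by (simp add: g_def act_mult reflect_basis act_uminus)
  then have "act g (basis_vec a) = (\<lambda>r. - basis_vec a r)"
    using \<open>c \<noteq> 0\<close> unfolding root act_scale fun_eq_iff by (metis mult_cancel_left mult_minus_right)
  then have ga: "act (g \<otimes> a) (basis_vec a) = basis_vec a"
    using g a by (simp add: act_mult_S_basis)
  have "g \<otimes> a = \<one>"
  proof (rule eq_one_of_nonneg_roots)
    fix r assume r: "r \<in> S"
    show "nonneg (act (g \<otimes> a) (basis_vec r))"
    proof (cases "r = a")
      case False
      have "act (g \<otimes> a) (basis_vec r) r = act g (reflect a (basis_vec r)) r" using g a by (simp add: act_mult)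
      also have "\<dots> = 1"
        using False x unfolding g_def act_reflection[OF x] root by (simp add: reflect_def)
      finally show ?thesis using root_sign[of "g \<otimes> a" r r] g a r by force
    qed (simp add: ga)
  qed (use g a in simp)
  then have "inv a = g" using g a by (intro inv_equality) auto
  then show ?thesis using a by (simp add: g_def)
qed

text \<open>A letter is deleted at the place where the image of the positive root of the reflection
  changes sign.\<close>

lemma exchange_of_negative_root:
  assumes "set ws \<subseteq> S" "x \<in> carrier W" "s \<in> S"
    and "nonneg (act x (basis_vec s))" "\<not> nonneg (act_word ws (act x (basis_vec s)))"
  shows "\<exists>us a vs. ws = us @ a # vs \<and> wv ws \<otimes> (x \<otimes> s \<otimes> inv x) = wv (us @ vs)"
  using assms
proof (induction ws)
  case (Cons a ws)
  define g where "g = x \<otimes> s \<otimes> inv x"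
  have g: "g \<in> carrier W" using Cons by (simp add: g_def)
  have ws: "wv ws \<in> carrier W" "set ws \<subseteq> S" "a \<in> S" using Cons by auto
  show ?case
  proof (cases "nonneg (act_word ws (act x (basis_vec s)))")
    case False
    then obtain us b vs where "ws = us @ b # vs" "wv ws \<otimes> g = wv (us @ vs)"
      using Cons by (auto simp: g_def)
    then have "a # ws = (a # us) @ b # vs \<and> wv (a # ws) \<otimes> g = wv ((a # us) @ vs)"
      using ws g by (simp add: m_assoc)
    then show ?thesis unfolding g_def by blast
  next
    case True
    define y where "y = wv ws \<otimes> x"
    have y: "y \<in> carrier W" using ws Cons by (simp add: y_def)
    have act_y: "act_word ws (act x (basis_vec s)) = act y (basis_vec s)"
      using ws Cons by (simp add: y_def act_mult act_wv)
    have ay: "act (a \<otimes> y) (basis_vec s) = reflect a (act y (basis_vec s))"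
      using ws y by (simp add: act_mult)
    have neg: "reflect a (act y (basis_vec s)) r \<le> 0" for r
      using Cons.prems(5) root_sign[of "a \<otimes> y" s r] ws y Cons.prems(3) by (simp add: ay act_y)
    \<comment> \<open>The reflection in \<open>a\<close> changes the coordinate \<open>a\<close>
      only, so every other coordinate is bounded by 0 from both sides.\<close>
    have "act y (basis_vec s) r = 0" if "r \<noteq> a" for r
      using neg[of r] True that unfolding act_y nonneg_def by (simp add: reflect_def) (metis antisym)
    then have "act y (basis_vec s) = (\<lambda>r. act y (basis_vec s) a * basis_vec a r)"
      by (auto simp: fun_eq_iff basis_vec_def)
    then have "y \<otimes> s \<otimes> inv y = a"
      using reflection_eq_of_root_proportional y ws Cons.prems(3) by blast
    then have "a \<otimes> wv ws = y \<otimes> s \<otimes> inv y \<otimes> wv ws" by simp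
    also have "\<dots> = wv ws \<otimes> g"
      using ws Cons.prems by (simp add: y_def g_def inv_mult_group m_assoc)
    finally have "wv (a # ws) \<otimes> g = wv ws" using ws g
      by (metis S_mult_cancel m_assoc wv_Cons S_closed)
    then have "a # ws = [] @ a # ws \<and> wv (a # ws) \<otimes> g = wv ([] @ ws)" by simp
    then show ?thesis unfolding g_def by blast
  qed
qed simp

text \<open>Replacing \<open>x\<close> by \<open>x \<otimes> s\<close> negates the root and keeps
  the reflection.\<close>

lemma reflectionsE:
  assumes "t \<in> reflections"
  obtains x s where "x \<in> carrier W" "s \<in> S" "t = x \<otimes> s \<otimes> inv x" "nonneg (act x (basis_vec s))"
proof -
  obtain x s where x: "x \<in> carrier W" "s \<in> S" "t = x \<otimes> s \<otimes> inv x"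
    using assms by (auto simp: reflections_def)
  show ?thesis
  proof (cases "nonneg (act x (basis_vec s))")
    case False
    then have "nonneg (act (x \<otimes> s) (basis_vec s))"
      using x root_sign[of x s] by (simp add: act_mult_S_basis nonneg_def)
    moreover have "t = (x \<otimes> s) \<otimes> s \<otimes> inv (x \<otimes> s)" using x by (simp add: inv_mult_group m_assoc)
    ultimately show ?thesis using that[of "x \<otimes> s" s] x by simp
  qed (use that x in blast)
qed

text \<open>If \<open>ws\<close> leaves the root of \<open>t\<close> positive, then a reduced word
  of \<open>wv ws \<otimes> t\<close> makes it negative. Deleting a letter there would make
  \<open>wv ws\<close> the shorter of the two elements, against the assumption.\<close>

theorem strong_exchange:
  assumes t: "t \<in> reflections" and ws: "set ws \<subseteq> S" and len: "len (wv ws \<otimes> t) < len (wv ws)"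
  shows "\<exists>us a vs. ws = us @ a # vs \<and> wv ws \<otimes> t = wv (us @ vs)"
proof -
  obtain x s where x: "x \<in> carrier W" "s \<in> S" "t = x \<otimes> s \<otimes> inv x" "nonneg (act x (basis_vec s))"
    using reflectionsE[OF t] .
  have tc: "t \<in> carrier W" "t \<otimes> t = \<one>" using x by (simp_all add: m_assoc inv_mult_cancel)
  show ?thesis
  proof (cases "nonneg (act_word ws (act x (basis_vec s)))")
    case False
    then show ?thesis using exchange_of_negative_root[OF ws x(1,2,4)] x by simp
  next
    case True
    obtain vs where vs: "reduced_word (wv ws \<otimes> t) vs" using ex_reduced[of "wv ws \<otimes> t"] ws tc by auto
    have "act_word vs (act x (basis_vec s)) = act (wv ws \<otimes> t) (act x (basis_vec s))"
      using vs act_wv[of vs] by (auto simp: reduced_word_iff)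
    also have "\<dots> = (\<lambda>r. - act_word ws (act x (basis_vec s)) r)"
      using ws x by (simp add: act_mult reflect_basis act_uminus act_wv act_word_uminus)
    finally have *: "act_word vs (act x (basis_vec s)) = (\<lambda>r. - act_word ws (act x (basis_vec s)) r)" .
    have "act_word ws (act x (basis_vec s)) = act (wv ws \<otimes> x) (basis_vec s)"
      using ws x by (simp add: act_mult act_wv)
    then obtain r where "act_word ws (act x (basis_vec s)) r \<noteq> 0"
      using root_nonzero[of "wv ws \<otimes> x" s] ws x by auto
    then have "\<not> nonneg (act_word vs (act x (basis_vec s)))"
      using True unfolding * nonneg_def by (metis antisym neg_0_le_iff_le)
    then obtain us a us' where del: "vs = us @ a # us'" "wv vs \<otimes> t = wv (us @ us')"
      using exchange_of_negative_root[of vs x s] vs x by (auto simp: reduced_word_iff)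
    have "wv vs \<otimes> t = wv ws" using vs ws tc by (simp add: reduced_word_iff m_assoc)
    then have "len (wv ws) \<le> length (us @ us')" using del vs len_wv_le[of "us @ us'"] by (auto simp: reduced_word_iff)
    then show ?thesis using len vs del by (auto simp: reduced_word_iff)
  qed
qed

end

subsection \<open>Bruhat order and the operators\<close>

lemma subseq_set_subset: "subseq us vs \<Longrightarrow> set us \<subseteq> set vs"
  by (induction rule: list_emb.induct) auto

context finite_coxeter_system
begin

lemma reflections_closed: "t \<in> reflections \<Longrightarrow> t \<in> carrier W"
  by (auto simp: reflections_def)

lemma reflection_mult_self [simp]:
  assumes "t \<in> reflections"
  shows "t \<otimes> t = \<one>"
proof -
  obtain y s where "y \<in> carrier W" "s \<in> S" "t = y \<otimes> s \<otimes> inv y"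
    using assms by (auto simp: reflections_def)
  then show ?thesis by (simp add: m_assoc inv_mult_cancel)
qed

lemma reflection_mult_cancel [simp]: "t \<in> reflections \<Longrightarrow> x \<in> carrier W \<Longrightarrow> x \<otimes> t \<otimes> t = x"
  by (simp add: m_assoc reflections_closed)

lemma even_len_mult_reflection:
  assumes "x \<in> carrier W" "t \<in> reflections"
  shows "even (len (x \<otimes> t)) \<longleftrightarrow> odd (len x)"
proof -
  obtain y s where t: "y \<in> carrier W" "s \<in> S" "t = y \<otimes> s \<otimes> inv y"
    using assms by (auto simp: reflections_def)
  then show ?thesis using assms by (simp add: even_len_mult)
qed

lemma bruhat_step_closed:
  "bruhat_step u w \<Longrightarrow> u \<in> carrier W" "bruhat_step u w \<Longrightarrow> w \<in> carrier W"
  by (auto simp: bruhat_step_def reflections_closed)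

lemma bruhat_step_len: "bruhat_step u w \<Longrightarrow> len u < len w"
  by (simp add: bruhat_step_def)

text \<open>Bruhat steps multiply on the right while the operators act on the left; conjugating
  \<open>s\<close> by \<open>x\<close> translates between the two.\<close>

lemma bruhat_step_left_mult:
  assumes "x \<in> carrier W" "s \<in> S" "len x < len (s \<otimes> x)"
  shows "bruhat_step x (s \<otimes> x)"
proof -
  have "inv x \<otimes> s \<otimes> inv (inv x) \<in> reflections"
    using assms unfolding reflections_def by blast
  moreover have "s \<otimes> x = x \<otimes> (inv x \<otimes> s \<otimes> inv (inv x))"
    using assms by (simp flip: m_assoc)
  ultimately show ?thesis using assms unfolding bruhat_step_def by blast
qed

lemma bruhat_step_word:
  assumes "bruhat_step u (wv ws)" "set ws \<subseteq> S"
  shows "\<exists>us a vs. ws = us @ a # vs \<and> u = wv (us @ vs)"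
proof -
  obtain t where t: "t \<in> reflections" "wv ws = u \<otimes> t" "u \<in> carrier W" "len u < len (wv ws)"
    using assms by (auto simp: bruhat_step_def)
  then have "wv ws \<otimes> t = u" by simp
  then show ?thesis using strong_exchange[OF t(1) assms(2)] t by auto
qed

text \<open>The core of the lifting property. If \<open>s\<close> reverses the order of lengths,
  then \<open>w\<close> has a reduced word starting with \<open>s\<close>, and exchange either
  deletes this \<open>s\<close> or makes \<open>s \<otimes> u\<close> too short.\<close>

lemma bruhat_step_left_mult_cases:
  assumes uw: "bruhat_step u w" and s: "s \<in> S"
  shows "w = s \<otimes> u \<or> bruhat_step (s \<otimes> u) (s \<otimes> w)"
proof (cases "len (s \<otimes> u) < len (s \<otimes> w)")
  case True
  have "u \<in> carrier W" "w \<in> carrier W" using bruhat_step_closed uw by auto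
  then show ?thesis using True uw s unfolding bruhat_step_def
    by (auto simp: m_assoc reflections_closed)
next
  case False
  obtain t where t: "t \<in> reflections" "w = u \<otimes> t" "u \<in> carrier W" "len u < len w"
    using uw by (auto simp: bruhat_step_def)
  have w: "w \<in> carrier W" using bruhat_step_closed uw by blast
  have "even (len (s \<otimes> w)) \<noteq> even (len (s \<otimes> u))"
    using even_len_mult_reflection[of "s \<otimes> u" t] t s by (simp add: m_assoc reflections_closed)
  then have "len (s \<otimes> w) < len (s \<otimes> u)" using False by (metis linorder_neqE_nat)
  \<comment> \<open>Single steps and parity leave only one possibility for the four lengths.\<close>
  then have l: "len (s \<otimes> u) = Suc (len u)" "len w = Suc (len (s \<otimes> w))" "len (s \<otimes> w) = len u"
    using t len_S_mult[OF t(3) s] len_S_mult[OF w s] by linarith+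
  obtain vs where vs: "set vs \<subseteq> S" "wv vs = s \<otimes> w" "length vs = len (s \<otimes> w)"
    using ex_reduced[of "s \<otimes> w"] w s by (auto simp: reduced_word_iff)
  have w_eq: "wv (s # vs) = w" using vs s w by simp
  then obtain us a vs' where del: "s # vs = us @ a # vs'" "u = wv (us @ vs')"
    using bruhat_step_word[of u "s # vs"] uw vs s by auto
  show ?thesis
  proof (cases us)
    case Nil
    then have "u = s \<otimes> w" using del vs by simp
    then show ?thesis using s w by simp
  next
    case (Cons b us')
    then have d: "b = s" "vs = us' @ a # vs'" using del by auto
    then have "s \<otimes> u = wv (us' @ vs')" using del Cons vs s by simp
    then have "len (s \<otimes> u) \<le> length (us' @ vs')" using d vs by (metis len_wv_le set_append Un_subset_iff set_subset_Cons subset_trans)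
    then show ?thesis using l d vs by simp
  qed
qed

lemma bruhat_le_refl [simp]: "bruhat_le w w"
  by (simp add: bruhat_le_def)

lemma bruhat_le_trans [trans]: "bruhat_le u v \<Longrightarrow> bruhat_le v w \<Longrightarrow> bruhat_le u w"
  by (simp add: bruhat_le_def)

lemma bruhat_le_step: "bruhat_step u w \<Longrightarrow> bruhat_le u w"
  by (simp add: bruhat_le_def r_into_rtranclp)

lemma bruhat_le_closed: "bruhat_le u w \<Longrightarrow> u \<in> carrier W \<longleftrightarrow> w \<in> carrier W"
  unfolding bruhat_le_def by (induction rule: rtranclp_induct) (auto dest: bruhat_step_closed)

lemma bruhat_le_len: "bruhat_le u w \<Longrightarrow> u = w \<or> len u < len w"
  unfolding bruhat_le_def by (induction rule: rtranclp_induct) (auto dest: bruhat_step_len)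

lemma bruhat_le_antisym: "bruhat_le u w \<Longrightarrow> bruhat_le w u \<Longrightarrow> u = w"
  using bruhat_le_len[of u w] bruhat_le_len[of w u] by auto

lemma one_bruhat_le: "w \<in> carrier W \<Longrightarrow> bruhat_le \<one> w"
proof (induction "len w" arbitrary: w rule: less_induct)
  case less
  show ?case
  proof (cases "w = \<one>")
    case False
    then obtain s where s: "s \<in> S" "len (s \<otimes> w) < len w" using ex_left_descent less by blast
    have "bruhat_step (s \<otimes> w) (s \<otimes> (s \<otimes> w))"
      using s less by (intro bruhat_step_left_mult) auto
    then have "bruhat_le (s \<otimes> w) w" using s less by (simp add: bruhat_le_step)
    then show ?thesis using less(1)[OF s(2)] less(2) s bruhat_le_trans by auto
  qed simp
qed

text \<open>Exchange holds for arbitrary words, so each Bruhat step down deletes one letter, whether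
  or not the word at hand is reduced.\<close>

lemma bruhat_le_subword:
  assumes "bruhat_le u (wv ws)" "set ws \<subseteq> S"
  shows "\<exists>vs. subseq vs ws \<and> wv vs = u"
  using assms(1) unfolding bruhat_le_def
proof (induction rule: converse_rtranclp_induct)
  case (step u v)
  then obtain vs where vs: "subseq vs ws" "wv vs = v" by blast
  then have "set vs \<subseteq> S" using assms(2) subseq_set_subset by blast
  then obtain us a us' where "vs = us @ a # us'" "u = wv (us @ us')"
    using bruhat_step_word[of u vs] step vs by auto
  then have "subseq (us @ us') vs" by (simp add: list_emb_Cons list_emb_append_mono)
  then show ?case using vs \<open>u = _\<close> subseq_order.trans by blast
qed auto

section \<open>The operators \<open>pi_gen\<close> and their upper adjoints\<close>

definition raise :: "'a \<Rightarrow> 'a \<Rightarrow> 'a" where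
  "raise s w = (if len w < len (s \<otimes> w) then s \<otimes> w else w)"

lemma pi_gen_closed [simp]: "s \<in> S \<Longrightarrow> w \<in> carrier W \<Longrightarrow> pi_gen s w \<in> carrier W"
  by (simp add: pi_gen_def)

lemma raise_closed [simp]: "s \<in> S \<Longrightarrow> w \<in> carrier W \<Longrightarrow> raise s w \<in> carrier W"
  by (simp add: raise_def)

lemma pi_gen_le: "s \<in> S \<Longrightarrow> w \<in> carrier W \<Longrightarrow> bruhat_le (pi_gen s w) w"
  using bruhat_step_left_mult[of "s \<otimes> w" s] by (auto simp: pi_gen_def intro: bruhat_le_step)

lemma raise_ge: "s \<in> S \<Longrightarrow> w \<in> carrier W \<Longrightarrow> bruhat_le w (raise s w)"
  using bruhat_step_left_mult[of w s] by (auto simp: raise_def intro: bruhat_le_step)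

lemma pi_gen_le_mult: "s \<in> S \<Longrightarrow> w \<in> carrier W \<Longrightarrow> bruhat_le (pi_gen s w) (s \<otimes> w)"
  using bruhat_step_left_mult[of w s] len_S_mult[of w s] by (auto simp: pi_gen_def intro: bruhat_le_step)

text \<open>Each operator picks the lower or upper element of a pair \<open>x\<close>,
  \<open>s \<otimes> x\<close>. If \<open>u\<close> and \<open>w\<close> form one pair the results
  coincide; otherwise the two pairs are comparable elementwise.\<close>

lemma pi_gen_raise_mono_step:
  assumes uw: "bruhat_step u w" and s: "s \<in> S"
  shows "bruhat_le (pi_gen s u) (pi_gen s w) \<and> bruhat_le (raise s u) (raise s w)"
proof -
  have c: "u \<in> carrier W" "w \<in> carrier W" using bruhat_step_closed uw by auto
  have le: "bruhat_le u w" "len u < len w" using uw bruhat_le_step bruhat_step_len by auto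
  have cmp: "len x < len (s \<otimes> x) \<and> \<not> len (s \<otimes> x) < len x \<and> bruhat_le x (s \<otimes> x) \<or>
      \<not> len x < len (s \<otimes> x) \<and> len (s \<otimes> x) < len x \<and> bruhat_le (s \<otimes> x) x" if x: "x \<in> carrier W" for x
    using bruhat_step_left_mult[of x s] bruhat_step_left_mult[of "s \<otimes> x" s] len_S_mult[OF x s] x s
    by (auto intro: bruhat_le_step)
  consider "w = s \<otimes> u" | "bruhat_le (s \<otimes> u) (s \<otimes> w)"
    using bruhat_step_left_mult_cases[OF uw s] bruhat_le_step by blast
  then show ?thesis
  proof cases
    case 1
    then show ?thesis using c s le by (auto simp: pi_gen_def raise_def)
  next
    case 2
    then show ?thesis using cmp[OF c(1)] cmp[OF c(2)] le
      unfolding pi_gen_def raise_def by (auto intro: bruhat_le_trans)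
  qed
qed

lemma pi_gen_mono:
  assumes "bruhat_le u w" "s \<in> S"
  shows "bruhat_le (pi_gen s u) (pi_gen s w)"
proof -
  have "bruhat_step\<^sup>*\<^sup>* u w" using assms(1) by (simp add: bruhat_le_def)
  then show ?thesis
  proof (induction rule: rtranclp_induct)
    case (step v w)
    then show ?case using pi_gen_raise_mono_step[OF step(2) assms(2)] bruhat_le_trans by blast
  qed simp
qed

lemma raise_mono:
  assumes "bruhat_le u w" "s \<in> S"
  shows "bruhat_le (raise s u) (raise s w)"
proof -
  have "bruhat_step\<^sup>*\<^sup>* u w" using assms(1) by (simp add: bruhat_le_def)
  then show ?thesis
  proof (induction rule: rtranclp_induct)
    case (step v w)
    then show ?case using pi_gen_raise_mono_step[OF step(2) assms(2)] bruhat_le_trans by blast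
  qed simp
qed

text \<open>A Galois connection: it is obtained from monotonicity and from the fact that the
  operators undo one another up to the choice within a pair.\<close>

lemma pi_gen_le_iff:
  assumes "s \<in> S" "x \<in> carrier W" "w \<in> carrier W"
  shows "bruhat_le (pi_gen s x) w \<longleftrightarrow> bruhat_le x (raise s w)"
proof
  assume "bruhat_le (pi_gen s x) w"
  then have "bruhat_le (raise s (pi_gen s x)) (raise s w)" using assms raise_mono by blast
  moreover have "raise s (pi_gen s x) = raise s x"
    using assms len_S_mult[of x s] by (auto simp: raise_def pi_gen_def)
  ultimately show "bruhat_le x (raise s w)"
    using raise_ge[of s x] assms bruhat_le_trans by metis
next
  assume "bruhat_le x (raise s w)"
  then have "bruhat_le (pi_gen s x) (pi_gen s (raise s w))" using assms pi_gen_mono by blast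
  moreover have "pi_gen s (raise s w) = pi_gen s w"
    using assms len_S_mult[of w s] by (auto simp: raise_def pi_gen_def)
  ultimately show "bruhat_le (pi_gen s x) w"
    using pi_gen_le[of s w] assms bruhat_le_trans by metis
qed

abbreviation pi_word :: "'a list \<Rightarrow> 'a \<Rightarrow> 'a" where
  "pi_word \<equiv> foldr pi_gen"

lemma pi_word_closed [simp]: "set ws \<subseteq> S \<Longrightarrow> x \<in> carrier W \<Longrightarrow> pi_word ws x \<in> carrier W"
  by (induction ws) auto

lemma pi_word_mono: "set ws \<subseteq> S \<Longrightarrow> bruhat_le u w \<Longrightarrow> bruhat_le (pi_word ws u) (pi_word ws w)"
  by (induction ws) (auto intro: pi_gen_mono)

text \<open>Adjoints compose in the opposite order, hence \<open>fold\<close> against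
  \<open>foldr\<close>.\<close>

lemma pi_word_le_iff:
  "set ws \<subseteq> S \<Longrightarrow> x \<in> carrier W \<Longrightarrow> w \<in> carrier W \<Longrightarrow>
    bruhat_le (pi_word ws x) w \<longleftrightarrow> bruhat_le x (fold raise ws w)"
  by (induction ws arbitrary: w) (auto simp: pi_gen_le_iff)

text \<open>\<open>pi_gen a x\<close> lies below both \<open>x\<close> and
  \<open>a \<otimes> x\<close>, so each letter may be skipped or used at will.\<close>

lemma pi_word_le_subword:
  assumes "set ws \<subseteq> S" "x \<in> carrier W" "subseq vs ws"
  shows "bruhat_le (pi_word ws x) (wv vs \<otimes> x)"
  using assms(3,1)
proof (induction rule: list_emb.induct)
  case (list_emb_Nil ws)
  then show ?case
  proof (induction ws)
    case (Cons a ws)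
    then have "bruhat_le (pi_gen a (pi_word ws x)) (pi_word ws x)"
      using assms(2) by (intro pi_gen_le) auto
    then show ?case using Cons by (auto intro: bruhat_le_trans)
  qed (use assms in simp)
next
  case (list_emb_Cons us ws a)
  then have "bruhat_le (pi_gen a (pi_word ws x)) (pi_word ws x)"
    using assms(2) by (intro pi_gen_le) auto
  then show ?case using list_emb_Cons by (auto intro: bruhat_le_trans)
next
  case (list_emb_Cons2 a b us ws)
  have us: "set us \<subseteq> S" using list_emb_Cons2 subseq_set_subset by fastforce
  then have "bruhat_le (pi_gen a (pi_word ws x)) (pi_gen a (wv us \<otimes> x))"
    using list_emb_Cons2 by (intro pi_gen_mono) auto
  also have "bruhat_le \<dots> (a \<otimes> (wv us \<otimes> x))"
    using list_emb_Cons2 us assms(2) by (intro pi_gen_le_mult) auto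
  finally show ?case using list_emb_Cons2 us assms(2) by (simp add: m_assoc)
qed

text \<open>Names the word hidden in \<open>pi_op\<close>; of this choice only the value and the
  length are known.\<close>

definition some_reduced :: "'a \<Rightarrow> 'a list" where
  "some_reduced u = (SOME ws. reduced_word u ws)"

lemma reduced_some_reduced: "u \<in> carrier W \<Longrightarrow> reduced_word u (some_reduced u)"
  unfolding some_reduced_def using ex_reduced by (rule someI_ex)

lemma set_some_reduced: "u \<in> carrier W \<Longrightarrow> set (some_reduced u) \<subseteq> S"
  using reduced_some_reduced by (auto simp: reduced_word_iff)

lemma pi_op_eq: "pi_op u = pi_word (some_reduced u)"
  by (simp add: pi_op_def some_reduced_def)

lemma pi_op_S: "s \<in> S \<Longrightarrow> pi_op s = pi_gen s"
proof -
  assume s: "s \<in> S"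
  then have "reduced_word s (some_reduced s)" by (simp add: reduced_some_reduced)
  then have r: "set (some_reduced s) \<subseteq> S" "wv (some_reduced s) = s" "length (some_reduced s) = 1"
    using s by (auto simp: reduced_word_iff)
  then obtain a where "some_reduced s = [a]" by (auto simp: length_Suc_conv)
  then have "some_reduced s = [s]" using r by simp
  then show ?thesis by (auto simp: pi_op_eq fun_eq_iff)
qed

lemma pi_op_le_mult:
  assumes "u \<in> carrier W" "x \<in> carrier W" "bruhat_le v u"
  shows "bruhat_le (pi_op u x) (v \<otimes> x)"
proof -
  have "reduced_word u (some_reduced u)" using assms reduced_some_reduced by blast
  then have r: "set (some_reduced u) \<subseteq> S" "wv (some_reduced u) = u" by (auto simp: reduced_word_iff)
  then obtain vs where "subseq vs (some_reduced u)" "wv vs = v"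
    using bruhat_le_subword[of v "some_reduced u"] assms by auto
  then show ?thesis using pi_word_le_subword[OF r(1) assms(2)] pi_op_eq by auto
qed

section \<open>Filters and the MacNeille closure\<close>

lemma order_filter_closed: "order_filter F \<Longrightarrow> x \<in> F \<Longrightarrow> x \<in> carrier W"
  by (auto simp: order_filter_def)

lemma order_filter_up: "order_filter F \<Longrightarrow> x \<in> F \<Longrightarrow> bruhat_le x y \<Longrightarrow> y \<in> F"
  unfolding order_filter_def using bruhat_le_closed by blast

text \<open>By the adjunction, \<open>tau u\<close> is the preimage under the composite of the
  \<open>raise\<close> operators.\<close>

lemma tau_alt:
  assumes "order_filter F" "u \<in> carrier W"
  shows "tau u F = {w \<in> carrier W. fold raise (some_reduced u) w \<in> F}"
proof -
  have ws: "set (some_reduced u) \<subseteq> S" using assms set_some_reduced by blast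
  have "fold raise (some_reduced u) w \<in> F \<longleftrightarrow> (\<exists>x\<in>F. bruhat_le x (fold raise (some_reduced u) w))" for w
    using assms order_filter_up by (auto intro: bexI[of _ "fold raise (some_reduced u) w"])
  then show ?thesis
    unfolding tau_def pi_op_eq using pi_word_le_iff[OF ws] order_filter_closed[OF assms(1)]
    by blast
qed

lemma Upper_bruhat:
  "F \<subseteq> carrier W \<Longrightarrow> Upper bruhat_order F = {w \<in> carrier W. \<forall>x\<in>F. bruhat_le x w}"
  unfolding Upper_def bruhat_order_def by auto

lemma Lower_bruhat:
  "F \<subseteq> carrier W \<Longrightarrow> Lower bruhat_order F = {w \<in> carrier W. \<forall>x\<in>F. bruhat_le w x}"
  unfolding Lower_def bruhat_order_def by auto

lemma Upper_in_Mac: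
  assumes "A \<subseteq> carrier W"
  shows "Upper bruhat_order A \<in> Mac"
proof -
  have U: "Upper bruhat_order A \<subseteq> carrier W" "Lower bruhat_order (Upper bruhat_order A) \<subseteq> carrier W"
    by (auto simp: Upper_def Lower_def bruhat_order_def)
  have "order_filter (Upper bruhat_order A)"
    using assms by (auto simp: order_filter_def Upper_bruhat intro: bruhat_le_trans)
  moreover have "Upper bruhat_order A = Upper bruhat_order (Lower bruhat_order (Upper bruhat_order A))"
    unfolding Upper_bruhat[OF U(2)] unfolding Lower_bruhat[OF U(1)] unfolding Upper_bruhat[OF assms]
    using assms by blast
  ultimately show ?thesis by (simp add: Mac_def)
qed

lemma MacE:
  assumes "F \<in> Mac"
  obtains A where "A \<subseteq> carrier W" "F = {w \<in> carrier W. \<forall>x\<in>A. bruhat_le x w}"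
proof -
  have "F = Upper bruhat_order (Lower bruhat_order F)" using assms by (simp add: Mac_def)
  moreover have "Lower bruhat_order F \<subseteq> carrier W" by (auto simp: Lower_def bruhat_order_def)
  ultimately show ?thesis using that Upper_bruhat by metis
qed

lemma Mac_order_filter: "F \<in> Mac \<Longrightarrow> order_filter F"
  by (simp add: Mac_def)

text \<open>Members of \<open>Mac\<close> are exactly sets of upper bounds. If \<open>F\<close>
  consists of the upper bounds of \<open>A\<close>, the adjunction makes \<open>tau u F\<close> the
  set of upper bounds of the image of \<open>A\<close>.\<close>

lemma tau_in_Mac:
  assumes "F \<in> Mac" "u \<in> carrier W"
  shows "tau u F \<in> Mac"
proof -
  have ws: "set (some_reduced u) \<subseteq> S" using assms set_some_reduced by blast
  obtain A where A: "A \<subseteq> carrier W" "F = {w \<in> carrier W. \<forall>x\<in>A. bruhat_le x w}"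
    using MacE[OF assms(1)] .
  have c: "fold raise vs w \<in> carrier W" if "w \<in> carrier W" "set vs \<subseteq> S" for vs w
    using that by (induction vs arbitrary: w) auto
  define B where "B = pi_word (some_reduced u) ` A"
  have B: "B \<subseteq> carrier W" using A ws by (auto simp: B_def)
  have iff: "(\<forall>x\<in>B. bruhat_le x w) \<longleftrightarrow> (\<forall>x\<in>A. bruhat_le x (fold raise (some_reduced u) w))"
    if "w \<in> carrier W" for w
    using pi_word_le_iff[OF ws _ that] A(1) by (auto simp: B_def subset_iff)
  have "tau u F = Upper bruhat_order B"
    unfolding tau_alt[OF Mac_order_filter[OF assms(1)] assms(2)] Upper_bruhat[OF B]
  proof (rule Collect_cong, rule conj_cong)
    fix w assume "w \<in> carrier W"
    then show "fold raise (some_reduced u) w \<in> F \<longleftrightarrow> (\<forall>x\<in>B. bruhat_le x w)"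
      using c[OF _ ws] iff by (simp add: A(2))
  qed simp
  then show ?thesis using Upper_in_Mac[OF B] by simp
qed


subsection \<open>Longest elements of parabolic subgroups\<close>

text \<open>All \<open>raise a\<close> with \<open>a\<close> in \<open>J\<close> fix
  \<open>w\<close>; by monotonicity left multiplication by such letters never leads out of the
  interval below \<open>w\<close>.\<close>

lemma bruhat_le_of_all_descents:
  assumes "w \<in> carrier W" "J \<subseteq> S" "\<And>s. s \<in> J \<Longrightarrow> len (s \<otimes> w) < len w" "v \<in> generate W J"
  shows "bruhat_le v w"
proof -
  obtain vs where "set vs \<subseteq> J" "wv vs = v" using generate_words[OF assms(2)] assms(4) by blast
  moreover have "bruhat_le (wv vs) w" if "set vs \<subseteq> J" for vs
    using that
  proof (induction vs)
    case (Cons a vs)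
    then have a: "a \<in> J" "a \<in> S" "set vs \<subseteq> S" using assms(2) by auto
    have "bruhat_le (raise a (wv vs)) (raise a w)" using Cons a raise_mono by auto
    moreover have "raise a w = w" using assms(3)[OF a(1)] by (simp add: raise_def)
    moreover have "bruhat_le (a \<otimes> wv vs) (raise a (wv vs))"
      using raise_ge[of a "a \<otimes> wv vs"] len_S_mult[of "wv vs" a] a by (auto simp: raise_def split: if_splits)
    ultimately show ?case using bruhat_le_trans by auto
  qed (use assms one_bruhat_le in simp)
  ultimately show ?thesis by blast
qed

lemma generate_closed [simp]: "J \<subseteq> S \<Longrightarrow> v \<in> generate W J \<Longrightarrow> v \<in> carrier W"
  using generate_incl[of J] S_carrier by blast

lemma longest_unique:
  assumes "J \<subseteq> S" "w \<in> generate W J" "\<And>s. s \<in> J \<Longrightarrow> len (s \<otimes> w) < len w"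
  shows "longest J = w"
proof -
  have le: "bruhat_le v w" if "v \<in> generate W J" for v
    using assms that by (intro bruhat_le_of_all_descents) auto
  then have "is_arg_max len (\<lambda>w. w \<in> generate W J) w"
    using assms bruhat_le_len by (fastforce simp: is_arg_max_def)
  moreover have "v = w" if "is_arg_max len (\<lambda>w. w \<in> generate W J) v" for v
    using that le[of v] assms(2) bruhat_le_len[of v w] by (auto simp: is_arg_max_def)
  ultimately show ?thesis unfolding longest_def by blast
qed

lemma ex_all_descents:
  assumes "J \<subseteq> S"
  shows "\<exists>w\<in>generate W J. \<forall>s\<in>J. len (s \<otimes> w) < len w"
proof -
  have "finite (generate W J)" using generate_closed[OF assms] by (intro finite_subset[OF _ finite_carrier] subsetI)
  moreover have "generate W J \<noteq> {}" using generate.one by blast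
  ultimately have fin: "finite (len ` generate W J)" "len ` generate W J \<noteq> {}" by auto
  then obtain w where w: "w \<in> generate W J" "len w = Max (len ` generate W J)"
    using Max_in by (metis imageE)
  have max: "len v \<le> len w" if "v \<in> generate W J" for v
    using Max_ge[OF fin(1)] that w(2) by simp
  have "len (s \<otimes> w) < len w" if "s \<in> J" for s
  proof -
    have "s \<otimes> w \<in> generate W J" using generate.eng[OF generate.incl[OF that] w(1)] .
    then have "len (s \<otimes> w) \<le> len w" by (rule max)
    moreover have "w \<in> carrier W" "s \<in> S" using that assms w(1) by auto
    ultimately show ?thesis using len_S_mult[of w s] by linarith
  qed
  then show ?thesis using w by blast
qed

lemma longest_in: "longest J \<in> generate W J"
    and longest_descent: "s \<in> J \<Longrightarrow> len (s \<otimes> longest J) < len (longest J)"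
  if J: "J \<subseteq> S"
proof -
  obtain w where w: "w \<in> generate W J" "\<And>s. s \<in> J \<Longrightarrow> len (s \<otimes> w) < len w"
    using ex_all_descents[OF J] by blast
  have "longest J = w" using J w by (rule longest_unique)
  then show "longest J \<in> generate W J"
    and "s \<in> J \<Longrightarrow> len (s \<otimes> longest J) < len (longest J)" using w by auto
qed

lemma longest_closed [simp]: "J \<subseteq> S \<Longrightarrow> longest J \<in> carrier W"
  using longest_in generate_closed by blast

lemma le_longest: "J \<subseteq> S \<Longrightarrow> v \<in> generate W J \<Longrightarrow> bruhat_le v (longest J)"
  by (rule bruhat_le_of_all_descents) (simp_all add: longest_descent)

text \<open>The inverse has all left descents and so is the longest element. The latter is its own
  inverse, since its inverse lies below it and has the same length.\<close>

lemma longest_S_eq: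
  assumes "w \<in> carrier W" "\<And>s. s \<in> S \<Longrightarrow> len (w \<otimes> s) < len w"
  shows "longest S = w"
proof -
  have "longest S = inv w"
  proof (rule longest_unique)
    fix s assume "s \<in> S"
    then show "len (s \<otimes> inv w) < len (inv w)"
      using assms(2)[of s] len_inv[of "w \<otimes> s"] assms(1) by (simp add: inv_mult_group)
  qed (use assms S_generates in auto)
  moreover have "longest S = inv (longest S)"
  proof -
    have l: "longest S \<in> carrier W" by simp
    have "len (inv (longest S)) = len (longest S)" using l by simp
    moreover have "bruhat_le (inv (longest S)) (longest S)"
      using l S_generates by (intro le_longest) auto
    ultimately show ?thesis using bruhat_le_len by fastforce
  qed
  ultimately show ?thesis using assms(1) by simp
qed

text \<open>Letters other than \<open>s\<close> never touch the coordinate \<open>s\<close>, which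
  stays 1, so the root at \<open>s\<close> cannot be negative.\<close>

lemma right_descent_generate:
  assumes "J \<subseteq> S" "w \<in> generate W J" "s \<in> S" "len (w \<otimes> s) < len w"
  shows "s \<in> J"
proof (rule ccontr)
  assume "s \<notin> J"
  obtain ws where ws: "set ws \<subseteq> J" "wv ws = w" using assms generate_words by blast
  then have "s \<notin> set ws" using \<open>s \<notin> J\<close> by blast
  then have "act w (basis_vec s) s = 1"
    using ws act_wv[of ws] act_word_other[of s ws] assms(1) by auto
  moreover have "act w (basis_vec s) s \<le> 0" using assms by (intro nonpos_root) auto
  ultimately show False by simp
qed

text \<open>Needed because \<open>pi_op\<close> uses an arbitrary reduced word: for an element of a
  parabolic subgroup, that word stays within its generators. The last letter is a right descent and
  is peeled off.\<close>

lemma reduced_word_generate: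
  assumes "J \<subseteq> S" "w \<in> generate W J" "reduced_word w ws"
  shows "set ws \<subseteq> J"
  using assms(2,3)
proof (induction ws arbitrary: w rule: rev_induct)
  case (snoc s ws)
  then have *: "set ws \<subseteq> S" "s \<in> S" "w = wv ws \<otimes> s" "len w = Suc (length ws)"
    by (auto simp: reduced_word_iff wv_append)
  have ws: "w \<otimes> s = wv ws" using * by simp
  have l: "len (wv ws) = length ws"
    using len_wv_le[OF *(1)] len_mult_le[of "wv ws" s] * by simp
  have s: "s \<in> J" using right_descent_generate[OF assms(1) snoc(2) *(2)] ws l * by simp
  then have "wv ws \<in> generate W J" using snoc(2) ws by (metis generate.eng generate.incl)
  then show ?case using snoc(1)[of "wv ws"] s * l by (simp add: reduced_word_iff)
qed simp


subsection \<open>Coxeter graph and Coxeter elements\<close>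

text \<open>Averaging over the group gives a positive definite invariant form. Each generator is an
  orthogonal reflection for it, so its values \<open>inv_form \<alpha>\<^sub>s v\<close> are positive multiples of
  \<open>2 v\<^sub>s - (A v)\<^sub>s\<close>. Evaluating at the sum of the simple roots in \<open>J\<close> bounds the degree of
  some vertex within \<open>J\<close>, so that the Coxeter graph is a forest.\<close>

definition inv_form :: "('a \<Rightarrow> real) \<Rightarrow> ('a \<Rightarrow> real) \<Rightarrow> real" where
  "inv_form u v = (\<Sum>w\<in>carrier W. \<Sum>r\<in>S. act w u r * act w v r)"

lemma inv_form_sym: "inv_form u v = inv_form v u"
  by (simp add: inv_form_def mult.commute)

lemma inv_form_act:
  assumes "x \<in> carrier W"
  shows "inv_form (act x u) (act x v) = inv_form u v"
proof -
  have "bij_betw (\<lambda>w. w \<otimes> x) (carrier W) (carrier W)"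
    by (rule bij_betw_byWitness[where f' = "\<lambda>w. w \<otimes> inv x"]) (use assms in \<open>auto simp: m_assoc\<close>)
  then have "(\<Sum>w\<in>carrier W. \<Sum>r\<in>S. act (w \<otimes> x) u r * act (w \<otimes> x) v r) = inv_form u v"
    unfolding inv_form_def by (rule sum.reindex_bij_betw)
  then show ?thesis using assms by (simp add: inv_form_def act_mult)
qed

lemma inv_form_combination: "inv_form u (\<lambda>r. v r + c * v' r) = inv_form u v + c * inv_form u v'"
  by (simp add: inv_form_def act_add act_scale algebra_simps sum.distrib sum_distrib_left)

lemma inv_form_uminus: "inv_form (\<lambda>r. - u r) v = - inv_form u v"
  by (simp add: inv_form_def act_uminus sum_negf)

lemma inv_form_sum: "finite A \<Longrightarrow> inv_form (\<lambda>r. \<Sum>i\<in>A. f i r) v = (\<Sum>i\<in>A. inv_form (f i) v)"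
proof (induction rule: finite_induct)
  case empty
  then show ?case by (simp add: inv_form_def act_zero)
next
  case (insert x A)
  then show ?case
    using inv_form_combination[of v "f x" 1 "\<lambda>r. \<Sum>i\<in>A. f i r"] by (simp add: inv_form_sym[of _ v])
qed

lemma inv_form_pos:
  assumes "r \<in> S" "u r \<noteq> 0"
  shows "0 < inv_form u u"
proof -
  have one: "0 < (\<Sum>r\<in>S. act \<one> u r * act \<one> u r)"
    using assms by (intro sum_pos2[of S r]) (auto simp: zero_less_mult_iff)
  show ?thesis
    unfolding inv_form_def
    by (rule sum_pos2[where f = "\<lambda>w. \<Sum>r\<in>S. act w u r * act w u r",
          OF finite_carrier one_closed one]) (simp add: sum_nonneg)
qed

lemma inv_form_basis:
  assumes s: "s \<in> S"
  shows "2 * inv_form (basis_vec s) v = (2 * v s - adj v s) * inv_form (basis_vec s) (basis_vec s)"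
proof -
  have r: "reflect s v = (\<lambda>r. v r + (adj v s - 2 * v s) * basis_vec s r)"
    by (auto simp: reflect_def basis_vec_def)
  have "- inv_form (basis_vec s) v = inv_form (reflect s (basis_vec s)) v"
    using s by (simp add: reflect_basis inv_form_uminus)
  also have "\<dots> = inv_form (reflect s (reflect s (basis_vec s))) (reflect s v)"
    using inv_form_act[of s "reflect s (basis_vec s)" v] s by simp
  also have "\<dots> = inv_form (basis_vec s) v + (adj v s - 2 * v s) * inv_form (basis_vec s) (basis_vec s)"
    unfolding r reflect_involution by (rule inv_form_combination)
  finally show ?thesis by (simp add: algebra_simps)
qed

lemma coxeter_edge_bond: "coxeter_edge s t \<Longrightarrow> bond s t \<noteq> 0"
proof -
  assume e: "coxeter_edge s t"
  then have st: "s \<in> S" "t \<in> S" "ord (s \<otimes> t) \<noteq> 1" "ord (s \<otimes> t) \<noteq> 2"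
    by (auto simp: coxeter_edge_def)
  show "bond s t \<noteq> 0"
  proof
    assume "bond s t = 0"
    then have "s \<otimes> t = t \<otimes> s" using bond_eq_0_iff_commute st by blast
    then have "(s \<otimes> t) \<otimes> (s \<otimes> t) = (t \<otimes> s) \<otimes> (s \<otimes> t)" by simp
    then have "(s \<otimes> t) [^] (2::nat) = \<one>" using st by (simp add: numeral_2_eq_2 m_assoc)
    then have "ord (s \<otimes> t) dvd 2" using st pow_eq_id by simp
    then have "ord (s \<otimes> t) = 1 \<or> ord (s \<otimes> t) = 2"
      using prime_nat_iff two_is_prime_nat by blast
    then show False using st by blast
  qed
qed

lemma forest_sum:
  assumes J: "J \<subseteq> S" "J \<noteq> {}"
  shows "\<exists>s\<in>J. (\<Sum>t\<in>J. bond s t) < 2"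
proof (rule ccontr)
  assume "\<not> ?thesis"
  then have ge: "\<And>s. s \<in> J \<Longrightarrow> 2 \<le> (\<Sum>t\<in>J. bond s t)" by fastforce
  define v :: "'a \<Rightarrow> real" where "v r = (\<Sum>s\<in>J. basis_vec s r)" for r
  have finJ: "finite J" using J finite_S finite_subset by blast
  have v: "v r = (if r \<in> J then 1 else 0)" for r
    using finJ by (simp add: v_def basis_vec_def)
  have adj_v: "adj v s = (\<Sum>t\<in>J. bond s t)" for s
    using J by (simp add: adj_def v if_distrib sum.If_cases Int_absorb1 cong: if_cong)
  have Q: "0 < inv_form (basis_vec s) (basis_vec s)" if "s \<in> S" for s
    using inv_form_pos[of s "basis_vec s"] that by simp
  \<comment> \<open>Were all weighted degrees at least 2, \<open>v\<close> would pair nonpositively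
    with each of its own summands, against positive definiteness.\<close>
  have "inv_form (basis_vec s) v \<le> 0" if "s \<in> J" for s
  proof -
    have s: "s \<in> S" using that J by blast
    have "2 * inv_form (basis_vec s) v = (2 - adj v s) * inv_form (basis_vec s) (basis_vec s)"
      using inv_form_basis[OF s, of v] that by (simp add: v)
    also have "\<dots> \<le> 0"
      using ge[OF that] Q[OF s] by (intro mult_nonpos_nonneg) (simp_all add: adj_v)
    finally show ?thesis by simp
  qed
  then have "(\<Sum>s\<in>J. inv_form (basis_vec s) v) \<le> 0" by (rule sum_nonpos)
  then have "inv_form v v \<le> 0" using inv_form_sum[OF finJ, of basis_vec v] by (simp add: v_def[abs_def])
  moreover obtain r where "r \<in> J" using J by blast
  then have "0 < inv_form v v" using inv_form_pos[of r v] J by (auto simp: v)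
  ultimately show False by simp
qed

text \<open>Two neighbours would contribute at least 1 each to a sum smaller than 2.\<close>

lemma leaf:
  assumes J: "J \<subseteq> S" "J \<noteq> {}"
  shows "\<exists>s\<in>J. \<forall>t\<in>J. \<forall>u\<in>J. bond s t \<noteq> 0 \<longrightarrow> bond s u \<noteq> 0 \<longrightarrow> t = u"
proof -
  have finJ: "finite J" using J finite_S finite_subset by blast
  obtain s where s: "s \<in> J" "(\<Sum>t\<in>J. bond s t) < 2" using forest_sum[OF assms] by blast
  have "t = u" if tu: "t \<in> J" "u \<in> J" "bond s t \<noteq> 0" "bond s u \<noteq> 0" for t u
  proof (rule ccontr)
    assume "t \<noteq> u"
    then have "bond s t + bond s u = (\<Sum>t\<in>{t, u}. bond s t)" by simp
    also have "\<dots> \<le> (\<Sum>t\<in>J. bond s t)"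
      using tu finJ by (intro sum_mono2) (auto simp: bond_nonneg)
    finally show False using s bond_ge_1[OF tu(3)] bond_ge_1[OF tu(4)] by simp
  qed
  then show ?thesis using s by blast
qed

lemma two_colouring:
  assumes "J \<subseteq> S"
  shows "\<exists>col :: 'a \<Rightarrow> bool. \<forall>s\<in>J. \<forall>t\<in>J. bond s t \<noteq> 0 \<longrightarrow> col s \<noteq> col t"
  using assms
proof (induction "card J" arbitrary: J)
  case 0
  then have "J = {}" using finite_S finite_subset by fastforce
  then show ?case by simp
next
  case (Suc n)
  have "finite J" using Suc(3) finite_S by (rule finite_subset)
  have "J \<noteq> {}" using Suc(2) by auto
  obtain x where x: "x \<in> J" "\<And>t u. t \<in> J \<Longrightarrow> u \<in> J \<Longrightarrow> bond x t \<noteq> 0 \<Longrightarrow> bond x u \<noteq> 0 \<Longrightarrow> t = u"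
    using leaf[OF Suc(3) \<open>J \<noteq> {}\<close>] by blast
  have "n = card (J - {x})" "J - {x} \<subseteq> S" using Suc(2,3) x(1) \<open>finite J\<close> by auto
  from Suc(1)[OF this] obtain col :: "'a \<Rightarrow> bool" where
    "\<forall>s\<in>J - {x}. \<forall>t\<in>J - {x}. bond s t \<noteq> 0 \<longrightarrow> col s \<noteq> col t" ..
  then have col: "col s \<noteq> col t" if "s \<in> J - {x}" "t \<in> J - {x}" "bond s t \<noteq> 0" for s t
    using that by blast
  have "\<exists>b. \<forall>t\<in>J. bond x t \<noteq> 0 \<longrightarrow> b \<noteq> col t"
  proof (cases "\<exists>t\<in>J. bond x t \<noteq> 0")
    case True
    then obtain t where t: "t \<in> J" "bond x t \<noteq> 0" by blast
    have "\<forall>u\<in>J. bond x u \<noteq> 0 \<longrightarrow> (\<not> col t) \<noteq> col u" using x(2)[OF t(1) _ t(2)] by auto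
    then show ?thesis by blast
  qed auto
  then obtain b where b: "\<And>t. t \<in> J \<Longrightarrow> bond x t \<noteq> 0 \<Longrightarrow> b \<noteq> col t" by blast
  have "(col(x := b)) s \<noteq> (col(x := b)) t" if st: "s \<in> J" "t \<in> J" "bond s t \<noteq> 0" for s t
  proof -
    have "s \<noteq> t" using st(3) by auto
    then consider "s = x" "t \<noteq> x" | "t = x" "s \<noteq> x" | "s \<noteq> x" "t \<noteq> x" by blast
    then show ?thesis
      using b[of s] b[of t] col[of s t] st bond_sym[of s t] by cases simp_all
  qed
  then show ?case by blast
qed

section \<open>Commutations and rotations of Coxeter words\<close>

inductive coxeter_move :: "'a list \<Rightarrow> 'a list \<Rightarrow> bool" where
  swap: "s \<otimes> t = t \<otimes> s \<Longrightarrow> coxeter_move (us @ s # t # vs) (us @ t # s # vs)"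
| rot: "coxeter_move (s # vs) (vs @ [s])"

lemma coxeter_move_set: "coxeter_move us vs \<Longrightarrow> set us = set vs \<and> (distinct us \<longleftrightarrow> distinct vs)"
  by (induction rule: coxeter_move.induct) auto

lemma coxeter_moves_rotate: "coxeter_move\<^sup>*\<^sup>* (us @ vs) (vs @ us)"
proof (induction us arbitrary: vs)
  case (Cons a us)
  have "coxeter_move ((a # us) @ vs) (us @ (vs @ [a]))" using rot[of a "us @ vs"] by simp
  also have "coxeter_move\<^sup>*\<^sup>* (us @ (vs @ [a])) ((vs @ [a]) @ us)" by (rule Cons)
  finally show ?case by simp
qed simp

lemma coxeter_moves_shift:
  "(\<And>y. y \<in> set ys \<Longrightarrow> x \<otimes> y = y \<otimes> x) \<Longrightarrow> coxeter_move\<^sup>*\<^sup>* (us @ ys @ x # vs) (us @ x # ys @ vs)"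
proof (induction ys arbitrary: vs rule: rev_induct)
  case (snoc y ys)
  have "coxeter_move ((us @ ys) @ y # x # vs) ((us @ ys) @ x # y # vs)"
    by (rule swap) (use snoc in simp)
  also have "coxeter_move\<^sup>*\<^sup>* \<dots> (us @ x # ys @ y # vs)" using snoc(1)[of "y # vs"] snoc(2) by simp
  finally show ?case by simp
qed simp

text \<open>Rotating \<open>z\<close> to the end meets the new first letter \<open>x\<close>. If
  they commute, \<open>z\<close> passes it. Otherwise \<open>z\<close> is the only neighbour of
  \<open>x\<close>: rotate both to the end, then bring \<open>x\<close> back through the rest, which
  commutes with it.\<close>

lemma coxeter_move_Cons:
  assumes "coxeter_move vs vs'" "distinct vs"
    and leaf: "\<And>t u. t \<in> set vs \<Longrightarrow> u \<in> set vs \<Longrightarrow> x \<otimes> t \<noteq> t \<otimes> x \<Longrightarrow> x \<otimes> u \<noteq> u \<otimes> x \<Longrightarrow> t = u"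
  shows "coxeter_move\<^sup>*\<^sup>* (x # vs) (x # vs')"
  using assms(1)
proof cases
  case (swap s t us ws)
  then have "coxeter_move ((x # us) @ s # t # ws) ((x # us) @ t # s # ws)"
    by (intro coxeter_move.swap)
  then show ?thesis using swap by auto
next
  case (rot z rest)
  show ?thesis
  proof (cases "x \<otimes> z = z \<otimes> x")
    case True
    have "coxeter_move (x # vs) (z # x # rest)"
      using coxeter_move.swap[OF True, of "[]" rest] rot by simp
    moreover have "coxeter_move (z # x # rest) (x # vs')" using coxeter_move.rot[of z "x # rest"] rot by simp
    ultimately show ?thesis by (meson converse_rtranclp_into_rtranclp r_into_rtranclp)
  next
    case False
    then have "x \<otimes> y = y \<otimes> x" if "y \<in> set rest" for y
      using leaf[of z y] that rot assms(2) by auto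
    then have "coxeter_move\<^sup>*\<^sup>* ([] @ rest @ x # [z]) ([] @ x # rest @ [z])"
      by (intro coxeter_moves_shift)
    moreover have "coxeter_move\<^sup>*\<^sup>* ([x, z] @ rest) (rest @ [x, z])" by (rule coxeter_moves_rotate)
    ultimately show ?thesis using rot by simp
  qed
qed

lemma coxeter_moves_Cons:
  assumes "coxeter_move\<^sup>*\<^sup>* vs vs'" "distinct vs"
    and leaf: "\<And>t u. t \<in> set vs \<Longrightarrow> u \<in> set vs \<Longrightarrow> x \<otimes> t \<noteq> t \<otimes> x \<Longrightarrow> x \<otimes> u \<noteq> u \<otimes> x \<Longrightarrow> t = u"
  shows "coxeter_move\<^sup>*\<^sup>* (x # vs) (x # vs')"
proof -
  have "coxeter_move\<^sup>*\<^sup>* (x # vs) (x # vs') \<and> set vs' = set vs \<and> distinct vs'"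
    using assms(1)
  proof (induction rule: rtranclp_induct)
    case (step us us')
    then have "coxeter_move\<^sup>*\<^sup>* (x # us) (x # us')"
      using leaf by (intro coxeter_move_Cons) auto
    then show ?case using step coxeter_move_set[OF step(2)] by auto
  qed (use assms in simp)
  then show ?thesis by blast
qed

text \<open>Induction on the forest: rotate a leaf to the front of both words and treat the
  remaining letters.\<close>

lemma coxeter_moves_enumerations:
  assumes "J \<subseteq> S"
    and "distinct us" "set us = J" "distinct vs" "set vs = J"
  shows "coxeter_move\<^sup>*\<^sup>* us vs"
  using assms
proof (induction "card J" arbitrary: J us vs)
  case 0
  then have "J = {}" using finite_S finite_subset by fastforce
  then show ?case using 0 by simp
next
  case (Suc n)
  have "finite J" using Suc(3) finite_S by (rule finite_subset)
  have "J \<noteq> {}" using Suc(2) by auto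
  obtain x where x: "x \<in> J" "\<And>t u. t \<in> J \<Longrightarrow> u \<in> J \<Longrightarrow> bond x t \<noteq> 0 \<Longrightarrow> bond x u \<noteq> 0 \<Longrightarrow> t = u"
    using leaf[OF Suc(3) \<open>J \<noteq> {}\<close>] by blast
  obtain us1 us2 where us: "us = us1 @ x # us2" using x Suc by (metis split_list)
  obtain vs1 vs2 where vs: "vs = vs1 @ x # vs2" using x Suc by (metis split_list)
  have su: "set (us2 @ us1) = J - {x}" "distinct (us2 @ us1)" using Suc us by auto
  have sv: "set (vs2 @ vs1) = J - {x}" "distinct (vs2 @ vs1)" using Suc vs by auto
  have "coxeter_move\<^sup>*\<^sup>* (us2 @ us1) (vs2 @ vs1)"
    by (rule Suc(1)[of "J - {x}"]) (use Suc(2,3) su sv x \<open>finite J\<close> in auto)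
  then have "coxeter_move\<^sup>*\<^sup>* (x # us2 @ us1) (x # vs2 @ vs1)"
  proof (rule coxeter_moves_Cons)
    fix t u assume "t \<in> set (us2 @ us1)" "u \<in> set (us2 @ us1)" "x \<otimes> t \<noteq> t \<otimes> x" "x \<otimes> u \<noteq> u \<otimes> x"
    then show "t = u" using x su Suc(3) bond_eq_0_iff_commute by (metis DiffD1 subsetD)
  qed (use su in auto)
  moreover have "coxeter_move\<^sup>*\<^sup>* us (x # us2 @ us1)" using coxeter_moves_rotate[of us1 "x # us2"] us by simp
  moreover have "coxeter_move\<^sup>*\<^sup>* (x # vs2 @ vs1) vs" using coxeter_moves_rotate[of "x # vs2" vs1] vs by simp
  ultimately show ?case by (meson rtranclp_trans)
qed

lemma ord_mult_commute:
  assumes "x \<in> carrier W" "y \<in> carrier W"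
  shows "ord (x \<otimes> y) = ord (y \<otimes> x)"
proof -
  have *: "ord (b \<otimes> a) dvd ord (a \<otimes> b)" if ab: "a \<in> carrier W" "b \<in> carrier W" for a b
  proof -
    define n where "n = ord (a \<otimes> b)"
    have "(a \<otimes> b) [^] k \<otimes> a = a \<otimes> (b \<otimes> a) [^] k" for k :: nat
    proof (induction k)
      case (Suc k)
      have "(a \<otimes> b) [^] Suc k \<otimes> a = ((a \<otimes> b) [^] k \<otimes> a) \<otimes> (b \<otimes> a)" using ab by (simp add: m_assoc)
      also have "\<dots> = a \<otimes> (b \<otimes> a) [^] Suc k" unfolding Suc using ab by (simp add: m_assoc)
      finally show ?case .
    qed (use ab in simp)
    moreover have "(a \<otimes> b) [^] n = \<one>" using ab by (simp add: n_def)
    ultimately have "a \<otimes> (b \<otimes> a) [^] n = a \<otimes> \<one>" using ab by (metis l_one r_one)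
    then have "(b \<otimes> a) [^] n = \<one>" using ab by simp
    then show ?thesis using ab pow_eq_id n_def by simp
  qed
  show ?thesis using *[OF assms] *[OF assms(2,1)] by (rule dvd_antisym[rotated])
qed

lemma coxeter_move_ord:
  assumes "coxeter_move us vs" "set us \<subseteq> S"
  shows "ord (wv us) = ord (wv vs)"
  using assms
proof (induction rule: coxeter_move.induct)
  case (swap s t us vs)
  then have "s \<otimes> (t \<otimes> wv vs) = t \<otimes> (s \<otimes> wv vs)" by (simp flip: m_assoc)
  then show ?case using swap by (simp add: wv_append)
next
  case (rot s vs)
  then show ?case using ord_mult_commute[of s "wv vs"] by (simp add: wv_append)
qed

lemma ord_coxeter_element:
  assumes "distinct us" "set us = S" "distinct vs" "set vs = S"
  shows "ord (wv us) = ord (wv vs)"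
proof -
  have "coxeter_move\<^sup>*\<^sup>* us vs" using coxeter_moves_enumerations[of S] assms by blast
  then have "ord (wv us) = ord (wv vs) \<and> set vs = S"
  proof (induction rule: rtranclp_induct)
    case (step vs vs')
    then show ?case using coxeter_move_ord[of vs vs'] coxeter_move_set[of vs vs'] by simp
  qed (use assms in simp)
  then show ?thesis by blast
qed

end

subsection \<open>Alternating products of bipartite blocks\<close>

locale coloured_coxeter_system = finite_coxeter_system +
  fixes col :: "'a \<Rightarrow> bool"
  assumes irreducible: irreducible_system
    and col: "\<And>s t. s \<in> S \<Longrightarrow> t \<in> S \<Longrightarrow> bond s t \<noteq> 0 \<Longrightarrow> col s \<noteq> col t"
begin

definition colour_class :: "bool \<Rightarrow> 'a set" where
  "colour_class b = {s \<in> S. col s = b}"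

definition block :: "bool \<Rightarrow> 'a list" where
  "block b = (SOME ws. distinct ws \<and> set ws = colour_class b)"

lemma colour_class_subset: "colour_class b \<subseteq> S"
  by (auto simp: colour_class_def)

lemma block: "distinct (block b)" "set (block b) = colour_class b"
proof -
  have "finite (colour_class b)" using colour_class_subset finite_S by (rule finite_subset)
  then have "\<exists>ws. distinct ws \<and> set ws = colour_class b" using finite_distinct_list by blast
  then have "distinct (block b) \<and> set (block b) = colour_class b" unfolding block_def by (rule someI_ex)
  then show "distinct (block b)" "set (block b) = colour_class b" by auto
qed

text \<open>\<open>b = even k\<close> is the colour of the \<open>k\<close>-th block, counted from \<open>0\<close>, of an alternating
  product of blocks starting with colour \<open>b\<close>.\<close>

fun block_word :: "bool \<Rightarrow> nat \<Rightarrow> 'a list" where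
  "block_word b 0 = []"
| "block_word b (Suc k) = block b @ block_word (\<not> b) k"

lemma set_block_word: "set (block_word b k) \<subseteq> S"
  using colour_class_subset by (induction k arbitrary: b) (auto simp: block)

lemma block_word_add: "block_word b (i + j) = block_word b i @ block_word (b = even i) j"
proof (induction i arbitrary: b)
  case (Suc i)
  have "((\<not> b) = even i) = (b = even (Suc i))" by auto
  then show ?case using Suc[of "\<not> b"] by simp
qed simp

lemma block_word_Suc: "block_word b (Suc k) = block_word b k @ block (b = even k)"
  using block_word_add[of b k 1] by simp

text \<open>At a vertex of one colour \<open>adj\<close> reads only the other colour, so the
  reflections of a colour class act simultaneously.\<close>

lemma act_class_word:
  assumes "distinct ws" "set ws \<subseteq> colour_class b"
  shows "act_word ws v = (\<lambda>r. if r \<in> set ws then adj v r - v r else v r)"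
  using assms
proof (induction ws)
  case (Cons a ws)
  define u where "u = act_word ws v"
  have u: "u = (\<lambda>r. if r \<in> set ws then adj v r - v r else v r)" using Cons by (simp add: u_def)
  have "adj u a = adj v a"
  proof (rule adj_cong)
    fix r assume "r \<in> S" "bond a r \<noteq> 0"
    then have "col a \<noteq> col r" using Cons(3) col by (auto simp: colour_class_def)
    then show "u r = v r" using Cons(3) by (auto simp: u colour_class_def)
  qed
  moreover have "u a = v a" using Cons(2) by (simp add: u)
  ultimately have "reflect a u = u(a := adj v a - v a)" by (simp add: reflect_def)
  then show ?case unfolding act_word_Cons u_def[symmetric] by (auto simp: u)
qed simp

text \<open>The action of such a word depends on its set of letters only, and the action is
  faithful.\<close>

lemma wv_class_perm:
  assumes "distinct us" "distinct vs" "set us = set vs" "set us \<subseteq> colour_class b"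
  shows "wv us = wv vs"
proof (rule act_faithful)
  have S: "set us \<subseteq> S" "set vs \<subseteq> S" using assms colour_class_subset by auto
  show "wv us \<in> carrier W" "wv vs \<in> carrier W" using S by simp_all
  fix s
  show "act (wv us) (basis_vec s) = act (wv vs) (basis_vec s)"
    using S assms by (simp add: act_wv act_class_word[where b = b])
qed

lemma inv_block: "inv (wv (block b)) = wv (block b)"
proof -
  have "inv (wv (block b)) = wv (rev (block b))" using colour_class_subset by (intro wv_rev[symmetric]) (simp add: block)
  also have "\<dots> = wv (block b)" by (rule wv_class_perm[where b = b]) (auto simp: block)
  finally show ?thesis .
qed

lemma wv_block_split:
  assumes "s \<in> colour_class b"
  shows "\<exists>ks. set ks \<subseteq> colour_class b \<and> length (block b) = Suc (length ks) \<and>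
    wv (block b) = s \<otimes> wv ks \<and> wv (block b) = wv ks \<otimes> s"
proof -
  define ks where "ks = remove1 s (block b)"
  have ks: "distinct ks" "set ks = colour_class b - {s}" "length (block b) = Suc (length ks)"
    using assms by (auto simp: ks_def block length_remove1) (metis Suc_pred block(2) length_pos_if_in_set)
  have "wv (block b) = wv (s # ks)"
    by (rule wv_class_perm[where b = b]) (use ks block assms in auto)
  moreover have "wv (block b) = wv (ks @ [s])"
    by (rule wv_class_perm[where b = b]) (use ks block assms in auto)
  moreover have "set ks \<subseteq> S" "s \<in> S" using ks assms colour_class_subset by auto
  ultimately show ?thesis using ks by (intro exI[of _ ks]) (auto simp: wv_append)
qed

text \<open>Chebyshev polynomials of the second kind in the adjacency operator. In the group
  they describe the images of the simple roots under alternating products of blocks.\<close>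

fun cheb :: "nat \<Rightarrow> ('a \<Rightarrow> real) \<Rightarrow> 'a \<Rightarrow> real" and cheb_prev :: "nat \<Rightarrow> ('a \<Rightarrow> real) \<Rightarrow> 'a \<Rightarrow> real" where
  "cheb 0 v = v"
| "cheb (Suc k) v = (\<lambda>r. adj (cheb k v) r - cheb_prev k v r)"
| "cheb_prev 0 v = (\<lambda>r. 0)"
| "cheb_prev (Suc k) v = cheb k v"

lemma adj_zero [simp]: "adj (\<lambda>r. 0) = (\<lambda>r. 0)"
  by (simp add: adj_def fun_eq_iff)

lemma adj_sum: "adj (\<lambda>r. \<Sum>i\<in>A. f i r) = (\<lambda>r. \<Sum>i\<in>A. adj (f i) r)"
proof
  fix r
  show "adj (\<lambda>r. \<Sum>i\<in>A. f i r) r = (\<Sum>i\<in>A. adj (f i) r)"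
    unfolding adj_def sum_distrib_left by (rule sum.swap)
qed

lemma adj_nonzeroE:
  assumes "adj v r \<noteq> 0"
  obtains t where "r \<in> S" "t \<in> S" "bond r t \<noteq> 0" "v t \<noteq> 0"
proof -
  obtain t where "t \<in> S" "bond r t * v t \<noteq> 0"
    using assms unfolding adj_def by (metis (mono_tags, lifting) sum.neutral)
  then show ?thesis using that by (auto simp: bond_def split: if_splits)
qed

text \<open>The adjacency operator exchanges the colours. Hence consecutive polynomials applied to a
  simple root have disjoint supports.\<close>

lemma cheb_support:
  assumes "u \<in> S"
  shows "(cheb k (basis_vec u) r \<noteq> 0 \<longrightarrow> r \<in> S \<and> col r = (col u = even k)) \<and>
    (cheb_prev k (basis_vec u) r \<noteq> 0 \<longrightarrow> r \<in> S \<and> col r = (col u = odd k))"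
proof (induction k arbitrary: r)
  case 0
  then show ?case using assms by (auto simp: basis_vec_def)
next
  case (Suc k)
  have "r \<in> S \<and> col r = (col u = even (Suc k))" if "cheb (Suc k) (basis_vec u) r \<noteq> 0"
  proof (cases "cheb_prev k (basis_vec u) r = 0")
    case False
    then show ?thesis using Suc by auto
  next
    case True
    then have "adj (cheb k (basis_vec u)) r \<noteq> 0" using that by simp
    then obtain t where t: "r \<in> S" "t \<in> S" "bond r t \<noteq> 0" "cheb k (basis_vec u) t \<noteq> 0"
      by (rule adj_nonzeroE)
    then show ?thesis using Suc[of t] col[of r t] by auto
  qed
  then show ?case using Suc by auto
qed

text \<open>The hypothesis gives \<open>u\<close> the colour of the next block to be appended on the
  right. Prefixing a block of colour \<open>b\<close> changes only coordinates of colour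
  \<open>b\<close>; these hold the older polynomial, and the recurrence turns it into the newer
  one.\<close>

lemma act_block_word:
  assumes u: "u \<in> S" and "col u = (b = even k)"
  shows "act_word (block_word b k) (basis_vec u) = (\<lambda>r. cheb k (basis_vec u) r + cheb_prev k (basis_vec u) r)"
  using assms(2)
proof (induction k arbitrary: b)
  case (Suc k)
  define p q where "p = cheb k (basis_vec u)" and "q = cheb_prev k (basis_vec u)"
  have IH: "act_word (block_word (\<not> b) k) (basis_vec u) = (\<lambda>r. p r + q r)"
    unfolding p_def q_def by (rule Suc(1)) (use Suc(2) in auto)
  have p: "r \<in> S \<and> col r \<noteq> b" if "p r \<noteq> 0" for r
    using cheb_support[OF u, of k r] that Suc(2) by (auto simp: p_def)
  have q: "r \<in> S \<and> col r = b" if "q r \<noteq> 0" for r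
    using cheb_support[OF u, of k r] that Suc(2) by (auto simp: q_def)
  have adj_q: "adj q r = 0" if "r \<in> colour_class b" for r
  proof (rule ccontr)
    assume "adj q r \<noteq> 0"
    then obtain t where "r \<in> S" "t \<in> S" "bond r t \<noteq> 0" "q t \<noteq> 0" by (rule adj_nonzeroE)
    then show False using q[of t] col[of r t] that by (simp add: colour_class_def)
  qed
  have adj_p: "adj p r = 0" if "r \<notin> colour_class b" for r
  proof (rule ccontr)
    assume "adj p r \<noteq> 0"
    then obtain t where "r \<in> S" "t \<in> S" "bond r t \<noteq> 0" "p t \<noteq> 0" by (rule adj_nonzeroE)
    then show False using p[of t] col[of r t] that by (auto simp: colour_class_def)
  qed
  have "act_word (block_word b (Suc k)) (basis_vec u) = act_word (block b) (\<lambda>r. p r + q r)"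
    by (simp add: IH)
  also have "\<dots> = (\<lambda>r. if r \<in> colour_class b then adj p r + adj q r - (p r + q r) else p r + q r)"
    by (simp add: act_class_word[OF block(1), of b b] block adj_add cong: if_cong)
  also have "\<dots> = (\<lambda>r. (adj p r - q r) + p r)"
    using adj_q adj_p p q by (fastforce simp: colour_class_def fun_eq_iff)
  finally show ?case by (simp add: p_def q_def)
qed simp

text \<open>Letters of one colour fix each other's simple roots, so the signs of the roots of
  \<open>x\<close> decide about all letters independently.\<close>

lemma len_class_word:
  assumes x: "x \<in> carrier W" and "distinct ks" "set ks \<subseteq> colour_class b"
    and "\<And>u. u \<in> set ks \<Longrightarrow> nonneg (act x (basis_vec u))"
  shows "len (x \<otimes> wv ks) = len x + length ks"
  using assms(2-)
proof (induction ks rule: rev_induct)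
  case (snoc u ks)
  have S: "set ks \<subseteq> S" "u \<in> S" using snoc(3) colour_class_subset by auto
  have "act_word ks (basis_vec u) = basis_vec u"
  proof -
    have "adj (basis_vec u) r = 0" if "r \<in> set ks" for r
      using that snoc(3) col[of r u] S adj_basis[of u r] by (auto simp: colour_class_def)
    moreover have "basis_vec u r = 0" if "r \<in> set ks" for r
      using that snoc(2) by (auto simp: basis_vec_def)
    moreover have "act_word ks (basis_vec u) =
        (\<lambda>r. if r \<in> set ks then adj (basis_vec u) r - basis_vec u r else basis_vec u r)"
      using snoc by (intro act_class_word[where b = b]) auto
    ultimately show ?thesis by auto
  qed
  then have "act (x \<otimes> wv ks) (basis_vec u) = act x (basis_vec u)"
    using S x by (simp add: act_mult act_wv)
  then have "nonneg (act (x \<otimes> wv ks) (basis_vec u))" using snoc(4) by simp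
  then have "len (x \<otimes> wv ks) < len (x \<otimes> wv ks \<otimes> u)"
    using nonneg_root_iff[of "x \<otimes> wv ks" u] S x by simp
  moreover have "x \<otimes> wv (ks @ [u]) = x \<otimes> wv ks \<otimes> u" using S x by (simp add: wv_append m_assoc)
  ultimately show ?case using snoc len_mult_S[of "x \<otimes> wv ks" u] S x by simp
qed (use x in simp)

section \<open>Positivity up to the first vanishing column\<close>

definition vanishes :: "nat \<Rightarrow> bool" where
  "vanishes k \<longleftrightarrow> (\<exists>u\<in>S. cheb k (basis_vec u) = (\<lambda>r. 0))"

text \<open>The root at \<open>u\<close> is the sum of two consecutive columns with disjoint
  supports. The older one is nonnegative and nonzero, which fixes the sign of the root and hence of
  the newer column.\<close>

lemma cheb_nonneg:
  assumes "\<And>j. j < k \<Longrightarrow> \<not> vanishes j" "u \<in> S"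
  shows "nonneg (cheb k (basis_vec u))"
  using assms
proof (induction k)
  case (Suc k)
  define b where "b = (col u = even (Suc k))"
  have cu: "col u = (b = even (Suc k))" by (auto simp: b_def)
  have root: "act (wv (block_word b (Suc k))) (basis_vec u) r = cheb (Suc k) (basis_vec u) r + cheb k (basis_vec u) r" for r
    using act_block_word[OF Suc(3) cu] set_block_word[of b "Suc k"] by (simp add: act_wv del: block_word.simps cheb.simps)
  have "cheb k (basis_vec u) \<noteq> (\<lambda>r. 0)" using Suc(2)[of k] Suc(3) by (auto simp: vanishes_def)
  then obtain r where r: "cheb k (basis_vec u) r \<noteq> 0" by (auto simp: fun_eq_iff)
  have nn: "nonneg (cheb k (basis_vec u))" using Suc by simp
  have disj: "cheb (Suc k) (basis_vec u) r = 0 \<or> cheb k (basis_vec u) r = 0" for r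
    using cheb_support[OF Suc(3), of "Suc k" r] cheb_support[OF Suc(3), of k r] by auto
  have "0 \<le> cheb k (basis_vec u) r" using nn by (simp add: nonneg_def)
  then have "0 < act (wv (block_word b (Suc k))) (basis_vec u) r" unfolding root using r disj[of r] by linarith
  moreover have "wv (block_word b (Suc k)) \<in> carrier W" using set_block_word[of b "Suc k"] by (simp del: block_word.simps)
  ultimately have "nonneg (act (wv (block_word b (Suc k))) (basis_vec u))"
    using root_sign Suc(3) by (metis not_less)
  then have "0 \<le> cheb (Suc k) (basis_vec u) r + cheb k (basis_vec u) r" for r
    unfolding nonneg_def root by blast
  then have "0 \<le> cheb (Suc k) (basis_vec u) r" for r
    using disj[of r] by (metis add.right_neutral order_refl)
  then show ?case by (simp add: nonneg_def del: cheb.simps)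
qed simp

lemma root_block_word_nonneg:
  assumes "\<And>j. j < k \<Longrightarrow> \<not> vanishes j" "u \<in> S" "col u = (b = even k)"
  shows "nonneg (act (wv (block_word b k)) (basis_vec u))"
proof -
  have "nonneg (cheb k (basis_vec u))" using assms cheb_nonneg by blast
  moreover have "nonneg (cheb_prev k (basis_vec u))"
    using assms cheb_nonneg by (cases k) (auto simp: nonneg_def)
  ultimately show ?thesis
    using act_block_word[OF assms(2,3)] set_block_word[of b k] by (simp add: act_wv nonneg_def)
qed

text \<open>\<open>Suc k\<close> blocks are allowed: appending the last one needs nonnegativity at
  \<open>k\<close>, which holds even if a column vanishes there.\<close>

lemma block_word_reduced:
  assumes "\<And>j. j < k \<Longrightarrow> \<not> vanishes j" "i \<le> Suc k"
  shows "len (wv (block_word b i)) = length (block_word b i)"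
  using assms(2)
proof (induction i)
  case (Suc i)
  have "len (wv (block_word b i) \<otimes> wv (block (b = even i))) = len (wv (block_word b i)) + length (block (b = even i))"
  proof (rule len_class_word)
    fix u assume "u \<in> set (block (b = even i))"
    then show "nonneg (act (wv (block_word b i)) (basis_vec u))"
      using Suc assms(1) by (intro root_block_word_nonneg) (auto simp: block colour_class_def)
  qed (use set_block_word in \<open>auto simp: block\<close>)
  then show ?case
    using Suc set_block_word[of b i] colour_class_subset[of "b = even i"] by (simp add: block_word_Suc wv_append block del: block_word.simps)
qed simp

text \<open>Otherwise there would be reduced block words of unbounded length in a finite
  group.\<close>

lemma ex_vanishes: "\<exists>k. vanishes k"
proof (rule ccontr)
  assume "\<not> ?thesis"
  then have red: "len (wv (block_word True i)) = length (block_word True i)" for i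
    using block_word_reduced[of i i True] by auto
  obtain s where "s \<in> S" using irreducible by (auto simp: irreducible_system_def)
  then have "s \<in> set (block True) \<union> set (block False)" by (auto simp: block colour_class_def)
  then have "block True @ block False \<noteq> []" by auto
  then have pos: "1 \<le> length (block True) + length (block False)"
    by (cases "block True"; cases "block False") auto
  have ge: "n \<le> length (block_word True (2 * n))" for n
    using pos by (induction n) auto
  define N where "N = Max (len ` carrier W)"
  have "len (wv (block_word True (2 * Suc N))) \<le> N"
    unfolding N_def using finite_carrier set_block_word by (intro Max_ge imageI wv_closed finite_imageI)
  then show False using ge[of "Suc N"] unfolding red by linarith
qed

text \<open>The m of the overview; it equals h - 1 by \<open>ord_bipartite\<close>.\<close>

definition zero_index :: nat where
  "zero_index = (LEAST k. vanishes k)"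

lemma vanishes_zero_index: "vanishes zero_index"
  unfolding zero_index_def using ex_vanishes by (rule LeastI_ex)

lemma not_vanishes: "j < zero_index \<Longrightarrow> \<not> vanishes j"
  unfolding zero_index_def by (rule not_less_Least)

lemma zero_index_pos: "0 < zero_index"
proof (rule ccontr)
  assume "\<not> 0 < zero_index"
  then have "vanishes 0" using vanishes_zero_index by simp
  then obtain u :: 'a where "basis_vec u = (\<lambda>r. 0)"
    unfolding vanishes_def cheb.simps by blast
  then show False by (metis basis_vec_simps(1) zero_neq_one)
qed

lemma cheb_adj: "cheb k (adj v) = adj (cheb k v) \<and> cheb_prev k (adj v) = adj (cheb_prev k v)"
  by (induction k) (simp_all add: adj_diff)

lemma cheb_sum: "cheb k (\<lambda>r. \<Sum>i\<in>A. f i r) = (\<lambda>r. \<Sum>i\<in>A. cheb k (f i) r) \<and>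
    cheb_prev k (\<lambda>r. \<Sum>i\<in>A. f i r) = (\<lambda>r. \<Sum>i\<in>A. cheb_prev k (f i) r)"
  by (induction k) (simp_all add: adj_sum sum_subtractf)

lemma cheb_scale: "cheb k (\<lambda>r. c * v r) = (\<lambda>r. c * cheb k v r) \<and>
    cheb_prev k (\<lambda>r. c * v r) = (\<lambda>r. c * cheb_prev k v r)"
  by (induction k) (simp_all add: adj_scale right_diff_distrib)

text \<open>The vanishing spreads along the edges: \<open>cheb zero_index\<close> commutes with the adjacency operator, and
  all summands below are nonnegative.\<close>

lemma cheb_zero_index_neighbour:
  assumes u: "u \<in> S" "cheb zero_index (basis_vec u) = (\<lambda>r. 0)" and t: "t \<in> S" "bond t u \<noteq> 0"
  shows "cheb zero_index (basis_vec t) = (\<lambda>r. 0)"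
proof
  fix r
  have "adj (basis_vec u) = (\<lambda>r. \<Sum>t\<in>S. bond t u * basis_vec t r)"
  proof
    fix r
    have "(\<Sum>t\<in>S. bond t u * basis_vec t r) = (if r \<in> S then bond r u else 0)"
      by (simp add: basis_vec_def if_distrib cong: if_cong)
    then show "adj (basis_vec u) r = (\<Sum>t\<in>S. bond t u * basis_vec t r)"
      using u by (simp add: adj_basis bond_def)
  qed
  then have "cheb zero_index (adj (basis_vec u)) = (\<lambda>r. \<Sum>t\<in>S. bond t u * cheb zero_index (basis_vec t) r)"
    using cheb_sum[of zero_index "\<lambda>t r. bond t u * basis_vec t r" S] cheb_scale[of zero_index] by simp
  then have "(\<Sum>t\<in>S. bond t u * cheb zero_index (basis_vec t) r) = 0"
    using cheb_adj[of zero_index "basis_vec u"] u by (simp add: fun_eq_iff)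
  moreover have "0 \<le> bond t u * cheb zero_index (basis_vec t) r" if "t \<in> S" for t
    using cheb_nonneg[OF not_vanishes that, of zero_index] bond_nonneg by (simp add: nonneg_def)
  ultimately have "bond t u * cheb zero_index (basis_vec t) r = 0"
    using t sum_nonneg_eq_0_iff[of S "\<lambda>t. bond t u * cheb zero_index (basis_vec t) r"] by auto
  then show "cheb zero_index (basis_vec t) r = 0" using t by simp
qed

lemma cheb_zero_index:
  assumes "u \<in> S"
  shows "cheb zero_index (basis_vec u) = (\<lambda>r. 0)"
proof -
  obtain s where s: "s \<in> S" "cheb zero_index (basis_vec s) = (\<lambda>r. 0)" using vanishes_zero_index by (auto simp: vanishes_def)
  have "coxeter_edge\<^sup>*\<^sup>* s u" using irreducible s assms by (auto simp: irreducible_system_def)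
  then show ?thesis
  proof (induction rule: rtranclp_induct)
    case (step t u)
    then have "t \<in> S" "u \<in> S" "bond u t \<noteq> 0"
      using coxeter_edge_bond[of t u] bond_sym[of t u] by (auto simp: coxeter_edge_def)
    then show ?case using cheb_zero_index_neighbour step by blast
  qed (use s in simp)
qed

section \<open>Block decompositions of the longest element\<close>

lemma block_word_closed [simp]: "wv (block_word b k) \<in> carrier W"
  using set_block_word by simp

lemma block_closed [simp]: "wv (block b) \<in> carrier W"
  using colour_class_subset by (simp add: block)

lemma len_block_word: "k \<le> Suc zero_index \<Longrightarrow> len (wv (block_word b k)) = length (block_word b k)"
  using block_word_reduced not_vanishes by blast

lemma wv_block_word_Suc: "wv (block_word b (Suc k)) = wv (block b) \<otimes> wv (block_word (\<not> b) k)"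
  using set_block_word colour_class_subset by (simp add: wv_append block)

text \<open>A letter of the last block can be deleted from it. For the other colour, the vanishing
  of column m turns the recurrence into
  \<open>U\<^sub>m\<^sub>+\<^sub>1 = - U\<^sub>m\<^sub>-\<^sub>1\<close>, so the root is the
  negative of a nonzero nonnegative column.\<close>

lemma block_word_right_descent:
  assumes u: "u \<in> S"
  shows "len (wv (block_word b (Suc zero_index)) \<otimes> u) < len (wv (block_word b (Suc zero_index)))"
proof (cases "col u = (b = even zero_index)")
  case True
  then obtain ks where ks: "set ks \<subseteq> colour_class (b = even zero_index)" "length (block (b = even zero_index)) = Suc (length ks)"
      "wv (block (b = even zero_index)) = wv ks \<otimes> u"
    using wv_block_split[of u "b = even zero_index"] u by (auto simp: colour_class_def)
  have S: "set ks \<subseteq> S" using ks colour_class_subset by blast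
  have "wv (block_word b (Suc zero_index)) = wv (block_word b zero_index) \<otimes> wv (block (b = even zero_index))"
    using set_block_word colour_class_subset by (simp add: block_word_Suc wv_append block del: block_word.simps)
  then have "wv (block_word b (Suc zero_index)) \<otimes> u = wv (block_word b zero_index @ ks)"
    using ks u S set_block_word by (simp add: m_assoc wv_append del: block_word.simps)
  then have "len (wv (block_word b (Suc zero_index)) \<otimes> u) \<le> length (block_word b zero_index @ ks)"
    using len_wv_le[of "block_word b zero_index @ ks"] S set_block_word by (simp del: block_word.simps)
  also have "\<dots> < length (block_word b (Suc zero_index))" using ks by (simp add: block_word_Suc del: block_word.simps)
  finally show ?thesis using len_block_word[of "Suc zero_index" b] by simp
next
  case False
  then have cu: "col u = (b = even (Suc zero_index))" by auto
  obtain k where k: "zero_index = Suc k" using zero_index_pos by (cases zero_index) auto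
  have "cheb (Suc zero_index) (basis_vec u) = (\<lambda>r. - cheb k (basis_vec u) r)"
    using cheb_zero_index[OF u] by (simp add: k del: cheb.simps(2)) (simp add: cheb.simps(2)[of "Suc k"] del: cheb.simps(2))
  then have root: "act (wv (block_word b (Suc zero_index))) (basis_vec u) = (\<lambda>r. - cheb k (basis_vec u) r)"
    using act_block_word[OF u cu] set_block_word[of b "Suc zero_index"] cheb_zero_index[OF u]
    by (simp add: act_wv del: block_word.simps cheb.simps)
  have "cheb k (basis_vec u) \<noteq> (\<lambda>r. 0)"
    using not_vanishes[of k] u by (auto simp: k vanishes_def)
  moreover have "nonneg (cheb k (basis_vec u))"
    using cheb_nonneg[OF _ u, of k] not_vanishes k by simp
  ultimately have "\<not> nonneg (act (wv (block_word b (Suc zero_index))) (basis_vec u))"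
    unfolding root nonneg_def fun_eq_iff by (metis antisym neg_0_le_iff_le)
  then show ?thesis
    using nonneg_root_iff[OF block_word_closed u, of b "Suc zero_index"] len_mult_S[OF block_word_closed u, of b "Suc zero_index"] by linarith
qed

lemma block_word_eq_longest: "wv (block_word b (Suc zero_index)) = longest S"
  using longest_S_eq[OF block_word_closed block_word_right_descent] by simp

text \<open>Prefixing a block of the other colour keeps the word reduced, as it then has at most m +
  1 blocks. Since \<open>s\<close> may be taken as the last letter of that block, it must lengthen
  the product.\<close>

lemma block_word_left_ascent:
  assumes "s \<in> S" "col s \<noteq> b" "k \<le> zero_index"
  shows "len (wv (block_word b k)) < len (s \<otimes> wv (block_word b k))"
proof -
  obtain ks where ks: "set ks \<subseteq> colour_class (\<not> b)" "length (block (\<not> b)) = Suc (length ks)"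
      "wv (block (\<not> b)) = wv ks \<otimes> s"
    using wv_block_split[of s "\<not> b"] assms by (auto simp: colour_class_def)
  have S: "set ks \<subseteq> S" using ks colour_class_subset by blast
  have "len (wv (block_word (\<not> b) (Suc k))) = length (block (\<not> b)) + len (wv (block_word b k))"
    using len_block_word[of "Suc k" "\<not> b"] len_block_word[of k b] assms by simp
  moreover have "wv (block_word (\<not> b) (Suc k)) = wv ks \<otimes> (s \<otimes> wv (block_word b k))"
    using assms S unfolding wv_block_word_Suc ks(3) by (simp add: m_assoc)
  moreover have "len (wv ks \<otimes> (s \<otimes> wv (block_word b k))) \<le> length ks + len (s \<otimes> wv (block_word b k))"
    using len_mult_le[of "wv ks" "s \<otimes> wv (block_word b k)"] len_wv_le[OF S] S assms by simp
  ultimately show ?thesis using ks by simp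
qed

lemma block_word_left_descent:
  assumes "s \<in> S" "col s = b" "k \<le> zero_index"
  shows "len (s \<otimes> wv (block_word b (Suc k))) < len (wv (block_word b (Suc k)))"
proof -
  obtain ks where ks: "set ks \<subseteq> colour_class b" "length (block b) = Suc (length ks)" "wv (block b) = s \<otimes> wv ks"
    using wv_block_split[of s b] assms by (auto simp: colour_class_def)
  have S: "set ks \<subseteq> S" using ks colour_class_subset by blast
  have "s \<otimes> wv (block_word b (Suc k)) = wv (ks @ block_word (\<not> b) k)"
    using assms S set_block_word unfolding wv_block_word_Suc ks(3) by (simp add: m_assoc wv_append)
  then have "len (s \<otimes> wv (block_word b (Suc k))) \<le> length (ks @ block_word (\<not> b) k)"
    using len_wv_le[of "ks @ block_word (\<not> b) k"] S set_block_word by simp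
  also have "\<dots> < length (block_word b (Suc k))" using ks by simp
  finally show ?thesis using len_block_word[of "Suc k" b] assms by simp
qed

text \<open>Blocks are involutions, so inversion reverses their order; for positive
  \<open>k\<close>, \<open>b = odd k\<close> is the colour of the last block.\<close>

lemma inv_block_word: "inv (wv (block_word b k)) = wv (block_word (b = odd k) k)"
proof (induction k arbitrary: b)
  case (Suc k)
  have e: "((\<not> b) = odd k) = (b = even k)" "((b = even k) = even k) = b" "(b = odd (Suc k)) = (b = even k)"
    by auto
  have "inv (wv (block_word b (Suc k))) = wv (block_word (b = even k) k) \<otimes> wv (block b)"
    unfolding wv_block_word_Suc using Suc[of "\<not> b"] by (simp add: inv_mult_group inv_block e)
  also have "\<dots> = wv (block_word (b = odd (Suc k)) (Suc k))"
    using set_block_word colour_class_subset by (simp add: block_word_Suc wv_append block e del: block_word.simps)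
  finally show ?case .
qed simp

text \<open>The k-th power has 2k blocks; its right half is the inverse of the k-block product with
  the other leading colour. So the power is trivial exactly when both k-block products agree. They
  do for m + 1 blocks, while from 1 to m blocks their left descents tell them apart.\<close>

lemma ord_bipartite: "ord (wv (block True @ block False)) = Suc zero_index"
proof -
  define c where "c = wv (block True @ block False)"
  have block_S: "set (block b) \<subseteq> S" for b using colour_class_subset by (simp add: block)
  have c: "c \<in> carrier W" using block_S by (simp add: c_def)
  have pow: "c [^] k = wv (block_word True (2 * k))" for k
  proof (induction k)
    case (Suc k)
    have "block_word True 2 = block True @ block False" by (simp add: numeral_2_eq_2)
    then have e: "block_word True (2 * k + 2) = block_word True (2 * k) @ block True @ block False"
      unfolding block_word_add by simp
    have "c [^] Suc k = wv (block_word True (2 * k)) \<otimes> c" using Suc by simp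
    also have "\<dots> = wv (block_word True (2 * k + 2))"
      using set_block_word block_S unfolding e by (simp add: c_def wv_append)
    finally show ?case by simp
  qed simp
  have one_iff: "c [^] k = \<one> \<longleftrightarrow> wv (block_word True k) = wv (block_word False k)" for k
  proof -
    have "c [^] k = wv (block_word True k) \<otimes> inv (wv (block_word False k))"
      using set_block_word unfolding pow mult_2 block_word_add inv_block_word by (simp add: wv_append)
    then show ?thesis using inv_solve_right'[of \<one> "wv (block_word True k)" "wv (block_word False k)"]
      by (metis block_word_closed l_one one_closed r_inv inv_closed inv_equality inv_inv)
  qed
  have "c [^] Suc zero_index = \<one>" unfolding one_iff block_word_eq_longest ..
  then have dvd: "ord c dvd Suc zero_index" using c pow_eq_id by blast
  then have le: "ord c \<le> Suc zero_index" by (rule dvd_imp_le) simp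
  have pos: "ord c \<noteq> 0" using dvd by (metis dvd_0_left_iff nat.distinct(1))
  have "\<not> ord c \<le> zero_index"
  proof
    assume ord: "ord c \<le> zero_index"
    obtain k where k: "ord c = Suc k" using pos by (cases "ord c") auto
    have eq: "wv (block_word True (Suc k)) = wv (block_word False (Suc k))"
      using one_iff[of "ord c"] pow_ord_eq_1[OF c] unfolding k by blast
    obtain s where s: "s \<in> S" using irreducible by (auto simp: irreducible_system_def)
    have "wv (block_word (col s) (Suc k)) = wv (block_word (\<not> col s) (Suc k))" using eq by (cases "col s") auto
    then show False
      using block_word_left_descent[OF s refl, of k] block_word_left_ascent[OF s, of "\<not> col s" "Suc k"] ord k by simp
  qed
  then show ?thesis using le by (simp add: c_def)
qed


subsection \<open>Iterating the pop-stack operator\<close>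

lemma Des_subset: "Des F \<subseteq> S"
  by (auto simp: Des_def)

lemma MacPop_in_Mac: "F \<in> Mac \<Longrightarrow> MacPop F \<in> Mac"
  unfolding MacPop_def using Des_subset by (intro tau_in_Mac longest_closed)

lemma MacPop_iterate_in_Mac: "F \<in> Mac \<Longrightarrow> (MacPop ^^ k) F \<in> Mac"
  by (induction k) (auto intro: MacPop_in_Mac)

text \<open>For \<open>a\<close> outside \<open>Des F\<close> the filter is stable under
  \<open>tau a\<close>, so a leading letter \<open>a\<close> may be dropped without leaving
  \<open>F\<close>.\<close>

lemma strip_non_descents:
  assumes "set ks \<subseteq> S - Des F" "y \<in> carrier W"
    and "len (wv ks \<otimes> y) = length ks + len y" "wv ks \<otimes> y \<in> F"
  shows "y \<in> F"
  using assms
proof (induction ks)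
  case (Cons a ks)
  define z where "z = wv ks \<otimes> y"
  have S: "a \<in> S" "a \<notin> Des F" "set ks \<subseteq> S" using Cons by auto
  have z: "z \<in> carrier W" using S Cons by (simp add: z_def)
  have az: "wv (a # ks) \<otimes> y = a \<otimes> z" using S Cons by (simp add: z_def m_assoc)
  have "len z \<le> length ks + len y"
    using len_mult_le[of "wv ks" y] len_wv_le[of ks] S Cons by (simp add: z_def)
  then have len: "len z = length ks + len y" "len z < len (a \<otimes> z)"
    using Cons(4) len_S_mult[OF z S(1)] unfolding az by auto
  have "pi_op a (a \<otimes> z) = z" using len S z by (simp add: pi_op_S pi_gen_def)
  moreover have "a \<otimes> z \<in> F" using Cons(5) az by simp
  ultimately have "z \<in> tau a F" unfolding tau_def using z bruhat_le_refl by force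
  then have "z \<in> F" using S by (auto simp: Des_def)
  then show ?case using Cons.IH Cons.prems len by (auto simp: z_def)
qed simp

text \<open>The inverse of \<open>wv ks\<close> lies in the parabolic subgroup, hence below its
  longest element, and \<open>pi_op_le_mult\<close> applies to it.\<close>

lemma pi_op_longest_le:
  assumes "J \<subseteq> S" "set ks \<subseteq> J" "y \<in> carrier W"
  shows "bruhat_le (pi_op (longest J) (wv ks \<otimes> y)) y"
proof -
  have S: "set ks \<subseteq> S" using assms by blast
  have "bruhat_le (wv (rev ks)) (longest J)"
    using assms generate_words[of J] by (intro le_longest) (auto intro!: exI[of _ "rev ks"])
  then have "bruhat_le (pi_op (longest J) (wv ks \<otimes> y)) (wv (rev ks) \<otimes> (wv ks \<otimes> y))"
    using assms S by (intro pi_op_le_mult) auto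
  then show ?thesis using S assms by (simp add: wv_rev inv_mult_cancel)
qed

text \<open>A whole block can be stripped: its letters outside \<open>Des F\<close> can be moved to the front, where
  stripping them does not leave \<open>F\<close>.\<close>

lemma MacPop_strip_block:
  assumes k: "k \<le> zero_index" and F: "wv (block_word b (Suc k)) \<in> F"
  shows "wv (block_word (\<not> b) k) \<in> MacPop F"
proof -
  define y where "y = wv (block_word (\<not> b) k)"
  define ks where "ks = filter (\<lambda>s. s \<in> Des F) (block b)"
  define ls where "ls = filter (\<lambda>s. s \<notin> Des F) (block b)"
  have y: "y \<in> carrier W" by (simp add: y_def)
  have block_S: "set (block b) \<subseteq> S" using colour_class_subset by (simp add: block)
  have sets: "set ks \<subseteq> Des F" "set ks \<subseteq> S" "set ls \<subseteq> S - Des F" "set ls \<subseteq> S"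
    using block_S by (auto simp: ks_def ls_def)
  have split: "wv (block b) = wv ls \<otimes> wv ks"
  proof -
    have "wv (block b) = wv (ls @ ks)"
      by (rule wv_class_perm[where b = b]) (auto simp: ks_def ls_def block)
    then show ?thesis using sets by (simp add: wv_append)
  qed
  have lens: "length (block b) = length ls + length ks"
    using sum_length_filter_compl[of "\<lambda>s. s \<in> Des F" "block b"] by (simp add: ks_def ls_def)
  have eq: "wv (block_word b (Suc k)) = wv ls \<otimes> (wv ks \<otimes> y)"
    unfolding wv_block_word_Suc split using sets y by (simp add: y_def m_assoc)
  have "len (wv ls \<otimes> (wv ks \<otimes> y)) = length ls + length ks + len y"
    using len_block_word[of "Suc k" b] len_block_word[of k "\<not> b"] k lens unfolding eq by (simp add: y_def)
  moreover have "len (wv ks \<otimes> y) \<le> length ks + len y"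
    using len_mult_le[of "wv ks" y] len_wv_le[OF sets(2)] sets y by simp
  moreover have "len (wv ls \<otimes> (wv ks \<otimes> y)) \<le> length ls + len (wv ks \<otimes> y)"
    using len_mult_le[of "wv ls" "wv ks \<otimes> y"] len_wv_le[OF sets(4)] sets y by simp
  \<comment> \<open>The sum of the two upper estimates is attained, so neither is strict.\<close>
  ultimately have "len (wv ls \<otimes> (wv ks \<otimes> y)) = length ls + len (wv ks \<otimes> y)" by linarith
  then have "wv ks \<otimes> y \<in> F"
    using strip_non_descents[OF sets(3), of "wv ks \<otimes> y"] F sets y unfolding eq by simp
  moreover have "bruhat_le (pi_op (longest (Des F)) (wv ks \<otimes> y)) y"
    by (rule pi_op_longest_le[OF Des_subset sets(1) y])
  ultimately show ?thesis unfolding MacPop_def tau_def using y by (auto simp: y_def)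
qed

text \<open>Stripping changes the leading colour, so the induction carries both colours; it starts
  because the longest element has a block decomposition with either one.\<close>

lemma MacPop_iterate_strip:
  assumes "longest S \<in> F" "i \<le> zero_index"
  shows "wv (block_word b (Suc zero_index - i)) \<in> (MacPop ^^ i) F"
  using assms(2)
proof (induction i arbitrary: b)
  case 0
  then show ?case using assms(1) block_word_eq_longest by simp
next
  case (Suc i)
  have e: "Suc zero_index - i = Suc (Suc zero_index - Suc i)" using Suc(2) by simp
  have "wv (block_word (\<not> b) (Suc (Suc zero_index - Suc i))) \<in> (MacPop ^^ i) F"
    using Suc(1)[of "\<not> b"] Suc(2) unfolding e by simp
  then have "wv (block_word (\<not> \<not> b) (Suc zero_index - Suc i)) \<in> MacPop ((MacPop ^^ i) F)"
    by (intro MacPop_strip_block) auto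
  then show ?case by simp
qed

text \<open>By the subword property \<open>x\<close> lies in both parabolic subgroups, so a right
  descent of \<open>x\<close> would have both colours.\<close>

lemma lower_bound_of_blocks:
  assumes "\<And>b. bruhat_le x (wv (block b))"
  shows "x = \<one>"
proof (rule ccontr)
  assume "x \<noteq> \<one>"
  have gen: "x \<in> generate W (colour_class b)" for b
  proof -
    obtain vs where "subseq vs (block b)" "wv vs = x"
      using bruhat_le_subword[OF assms, of b] colour_class_subset by (auto simp: block)
    then show ?thesis using generate_words[OF colour_class_subset] subseq_set_subset block(2) by blast
  qed
  have "x \<in> carrier W" using gen colour_class_subset by (rule generate_closed[rotated])
  then obtain s where "s \<in> S" "len (x \<otimes> s) < len x" using ex_right_descent \<open>x \<noteq> \<one>\<close> by blast
  then have "s \<in> colour_class b" for b using right_descent_generate[OF colour_class_subset gen] by blast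
  from this[of True] this[of False] show False by (auto simp: colour_class_def)
qed

lemma Mac_longest_mem:
  assumes "F \<in> Mac"
  shows "longest S \<in> F"
proof -
  obtain A where "A \<subseteq> carrier W" "F = {w \<in> carrier W. \<forall>x\<in>A. bruhat_le x w}" using MacE[OF assms] .
  then show ?thesis using le_longest[of S] S_generates by auto
qed

lemma MacPop_iterate_zero_index:
  assumes "F \<in> Mac"
  shows "(MacPop ^^ zero_index) F = carrier W"
proof -
  obtain A where A: "A \<subseteq> carrier W" "(MacPop ^^ zero_index) F = {w \<in> carrier W. \<forall>x\<in>A. bruhat_le x w}"
    using MacE[OF MacPop_iterate_in_Mac[OF assms]] .
  have "wv (block b) \<in> (MacPop ^^ zero_index) F" for b
    using MacPop_iterate_strip[OF Mac_longest_mem[OF assms], of zero_index b] by simp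
  then have "x = \<one>" if "x \<in> A" for x
    using that A by (intro lower_bound_of_blocks) auto
  then show ?thesis using A one_bruhat_le by auto
qed

section \<open>Principal filters and the lower bound\<close>

definition up :: "'a \<Rightarrow> 'a set" where
  "up x = {w \<in> carrier W. bruhat_le x w}"

lemma up_in_Mac: "x \<in> carrier W \<Longrightarrow> up x \<in> Mac"
  using Upper_in_Mac[of "{x}"] Upper_bruhat[of "{x}"] by (simp add: up_def)

lemma up_inject: "x \<in> carrier W \<Longrightarrow> y \<in> carrier W \<Longrightarrow> up x = up y \<longleftrightarrow> x = y"
  unfolding up_def using bruhat_le_antisym bruhat_le_refl by blast

lemma tau_up:
  assumes "u \<in> carrier W" "x \<in> carrier W"
  shows "tau u (up x) = up (pi_op u x)"
proof -
  have "bruhat_le (pi_op u x) (pi_op u y)" if "bruhat_le x y" for y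
    unfolding pi_op_eq using that set_some_reduced[OF assms(1)] by (intro pi_word_mono)
  then show ?thesis unfolding tau_def up_def using assms(2) by (auto intro: bruhat_le_trans)
qed

lemma Des_up:
  assumes x: "x \<in> carrier W"
  shows "Des (up x) = {s \<in> S. len (s \<otimes> x) < len x}"
proof -
  have "tau s (up x) \<noteq> up x \<longleftrightarrow> len (s \<otimes> x) < len x" if s: "s \<in> S" for s
  proof -
    have "tau s (up x) = up (pi_gen s x)" using tau_up[of s x] s x by (simp add: pi_op_S)
    then have "tau s (up x) \<noteq> up x \<longleftrightarrow> pi_gen s x \<noteq> x"
      using up_inject[of "pi_gen s x" x] s x by simp
    also have "\<dots> \<longleftrightarrow> len (s \<otimes> x) < len x"
      unfolding pi_gen_def by (metis less_irrefl)
    finally show ?thesis .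
  qed
  then show ?thesis unfolding Des_def by blast
qed

text \<open>With at most m blocks, the left descents are exactly the leading colour. The product
  \<open>y\<close> of the remaining blocks has no left descent of that colour, so
  \<open>pi_op u\<close> fixes it; monotonicity and \<open>y\<close> below \<open>x\<close> give one
  inequality, and stripping the block gives the other.\<close>

lemma MacPop_up_block_word:
  assumes "Suc k \<le> zero_index"
  shows "MacPop (up (wv (block_word b (Suc k)))) = up (wv (block_word (\<not> b) k))"
proof -
  define x where "x = wv (block_word b (Suc k))"
  define y where "y = wv (block_word (\<not> b) k)"
  have c: "x \<in> carrier W" "y \<in> carrier W" by (simp_all add: x_def y_def del: block_word.simps)
  have "len (s \<otimes> x) < len x \<longleftrightarrow> col s = b" if "s \<in> S" for s
  proof (cases "col s = b")
    case True
    then show ?thesis using block_word_left_descent[OF that, of b k] assms by (simp add: x_def del: block_word.simps)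
  next
    case False
    then show ?thesis using block_word_left_ascent[OF that, of b "Suc k"] assms by (simp add: x_def del: block_word.simps)
  qed
  then have Des: "Des (up x) = colour_class b" unfolding Des_up[OF c(1)] colour_class_def by blast
  define u where "u = longest (colour_class b)"
  have u: "u \<in> generate W (colour_class b)" "u \<in> carrier W"
    using colour_class_subset by (auto simp: u_def longest_in)
  have x: "x = wv (block b) \<otimes> y" by (simp only: x_def y_def wv_block_word_Suc)
  have le: "bruhat_le (pi_op u x) y"
    unfolding u_def x by (rule pi_op_longest_le[OF colour_class_subset _ c(2)]) (simp add: block)
  have "pi_gen s y = y" if "s \<in> colour_class b" for s
    using block_word_left_ascent[of s "\<not> b" k] that assms by (auto simp: pi_gen_def y_def colour_class_def)
  then have "pi_word ws y = y" if "set ws \<subseteq> colour_class b" for ws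
    using that by (induction ws) auto
  then have fix_y: "pi_op u y = y"
    unfolding pi_op_eq
    using reduced_word_generate[OF colour_class_subset u(1) reduced_some_reduced[OF u(2)]] .
  have "wv (block b) \<in> generate W (colour_class b)"
    unfolding generate_words[OF colour_class_subset] by (intro exI[of _ "block b"]) (simp add: block)
  then have "bruhat_le (wv (block b)) u" unfolding u_def by (rule le_longest[OF colour_class_subset])
  then have "bruhat_le (pi_op u y) (wv (block b) \<otimes> y)" using u(2) c(2) by (intro pi_op_le_mult)
  then have "bruhat_le y x" by (simp add: fix_y x)
  then have "bruhat_le (pi_op u y) (pi_op u x)"
    unfolding pi_op_eq using set_some_reduced[OF u(2)] by (intro pi_word_mono)
  then have "pi_op u x = y" using le fix_y bruhat_le_antisym by simp
  then have "MacPop (up x) = up y" unfolding MacPop_def Des using tau_up[OF u(2) c(1)] by (simp add: u_def)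
  then show ?thesis by (simp only: x_def y_def)
qed

lemma MacPop_iterate_up_block_word:
  assumes "i \<le> zero_index"
  shows "(MacPop ^^ i) (up (wv (block_word b zero_index))) = up (wv (block_word (b = even i) (zero_index - i)))"
  using assms
proof (induction i)
  case (Suc i)
  have e: "zero_index - i = Suc (zero_index - Suc i)" using Suc by simp
  have "(b = even (Suc i)) = (\<not> (b = even i))" by auto
  then show ?case using Suc MacPop_up_block_word[of "zero_index - Suc i" "b = even i"] unfolding e
    by (simp del: block_word.simps)
qed simp

lemma MacPop_carrier: "MacPop (carrier W) = carrier W"
proof -
  define u where "u = longest (Des (carrier W))"
  have u: "u \<in> carrier W" using Des_subset by (simp add: u_def)
  have "bruhat_le (pi_op u \<one>) w" if "w \<in> carrier W" for w
    using pi_op_le_mult[of u \<one> \<one>] one_bruhat_le that u bruhat_le_trans by fastforce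
  then show ?thesis unfolding MacPop_def tau_def u_def[symmetric] by blast
qed

lemma MacPop_iterate_carrier: "(MacPop ^^ k) (carrier W) = carrier W"
  by (induction k) (auto simp: MacPop_carrier)

lemma slow_filter: "\<exists>F\<in>Mac. \<forall>t<zero_index. (MacPop ^^ t) F \<noteq> carrier W"
proof -
  obtain s where s: "s \<in> S" using irreducible by (auto simp: irreducible_system_def)
  \<comment> \<open>Chosen so that the last remaining block has the colour of an existing generator:
    in rank one the other class is empty and its block would be trivial.\<close>
  define b where "b = (col s = even (zero_index - 1))"
  define F where "F = up (wv (block_word b zero_index))"
  have "(b = even (zero_index - 1)) = col s" by (auto simp: b_def)
  then have last: "(MacPop ^^ (zero_index - 1)) F = up (wv (block (col s)))"
    using MacPop_iterate_up_block_word[of "zero_index - 1" b] zero_index_pos by (simp add: F_def)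
  have "s \<in> set (block (col s))" using s by (simp add: block colour_class_def)
  then have "0 < length (block (col s))" by (rule length_pos_if_in_set)
  then have "0 < len (wv (block (col s)))" using len_block_word[of 1 "col s"] by simp
  then have "\<one> \<notin> up (wv (block (col s)))" using bruhat_le_len by (fastforce simp: up_def)
  then have ne: "(MacPop ^^ (zero_index - 1)) F \<noteq> carrier W" using last by auto
  have "(MacPop ^^ t) F \<noteq> carrier W" if "t < zero_index" for t
  proof
    assume "(MacPop ^^ t) F = carrier W"
    \<comment> \<open>W is a fixed point, so reaching it early would contradict the state after m -
      1 steps.\<close>
    then have "(MacPop ^^ ((zero_index - 1 - t) + t)) F = carrier W"
      by (simp add: funpow_add MacPop_iterate_carrier)
    then show False using ne that by simp
  qed
  moreover have "F \<in> Mac" using up_in_Mac by (simp add: F_def)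
  ultimately show ?thesis by blast
qed

lemma Max_MacPop_time:
  "Max ((\<lambda>F. LEAST t. (MacPop ^^ t) F = carrier W) ` Mac) = zero_index"
proof (rule Max_eqI)
  have "Mac \<subseteq> Pow (carrier W)" by (auto simp: Mac_def order_filter_def)
  then show "finite ((\<lambda>F. LEAST t. (MacPop ^^ t) F = carrier W) ` Mac)"
    using finite_carrier finite_subset by blast
  show "t \<le> zero_index" if "t \<in> (\<lambda>F. LEAST t. (MacPop ^^ t) F = carrier W) ` Mac" for t
    using that MacPop_iterate_zero_index by (auto intro: Least_le)
  obtain F where F: "F \<in> Mac" "\<And>t. t < zero_index \<Longrightarrow> (MacPop ^^ t) F \<noteq> carrier W"
    using slow_filter by blast
  then have "(LEAST t. (MacPop ^^ t) F = carrier W) = zero_index"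
    using MacPop_iterate_zero_index[of F] by (intro Least_equality) (auto simp: not_less[symmetric])
  then show "zero_index \<in> (\<lambda>F. LEAST t. (MacPop ^^ t) F = carrier W) ` Mac" using F(1) by force
qed

end

theorem theorem1p6:
  fixes W :: "('a, 'b) monoid_scheme" and S :: "'a set" and h :: nat
  assumes "coxeter_system W S"
    and "finite (carrier W)"
    and "coxeter_system.irreducible_system W S"
    and "coxeter_system.is_coxeter_number W S h"
  shows "(\<forall>F \<in> coxeter_system.Mac W S. \<exists>t. (coxeter_system.MacPop W S ^^ t) F = carrier W) \<and>
    Max ((\<lambda>F. LEAST t. (coxeter_system.MacPop W S ^^ t) F = carrier W) ` coxeter_system.Mac W S)
      = h - 1"
proof -
  interpret finite_coxeter_system W S
    using assms(1,2) by (intro finite_coxeter_system.intro finite_coxeter_system_axioms.intro)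
  obtain col :: "'a \<Rightarrow> bool" where col: "\<forall>s\<in>S. \<forall>t\<in>S. bond s t \<noteq> 0 \<longrightarrow> col s \<noteq> col t"
    using two_colouring[OF subset_refl] ..
  interpret coloured_coxeter_system W S col
    by unfold_locales (use assms(3) col in blast)+
  obtain ws where ws: "distinct ws" "set ws = S" "h = ord (wv ws)"
    using assms(4) by (auto simp: is_coxeter_number_def coxeter_element_def)
  have "distinct (block True @ block False)" "set (block True @ block False) = S"
    using block by (auto simp: colour_class_def)
  \<comment> \<open>The Coxeter element behind \<open>h\<close> is arbitrary, but all of them share
    the order of the bipartite one.\<close>
  then have "h = Suc zero_index"
    using ord_coxeter_element[OF ws(1,2)] ws(3) ord_bipartite by metis
  then show ?thesis using MacPop_iterate_zero_index Max_MacPop_time by auto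
qed

end
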